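(* Let $\{\varphi_r\}_{0<r<1}$ be an arbitrary approximate identity on $\mathbb{T}$, let $1\le p<\infty$, and let $\lambda:(0,1)\to(0,\infty)$ be a function satisfying $$\tilde\Pi_p(\lambda,\varphi):=\sup_{0<r<1}\lambda(r)\,\|\varphi_r\|_\infty\,\varphi_*(r)^{p-1}<\infty .$$ Then there is a constant $C$, not depending on $f$, such that for every $f\in L^p(\mathbb{T})$ $$\Phi_\lambda^*(x,f)\le C\,\bigl(M|f|^p(x)\bigr)^{1/p},\qquad x\in\mathbb{T}.$$ In particular, the operator $\Phi_\lambda^*$ is of weak type $(p,p)$: there is a constant $\tilde C$, not depending on $f$ and $t$, such that $$\bigl|\{x\in\mathbb{T}:\Phi_\lambda^*(x,f)>t\}\bigr|\le\frac{\tilde C}{t^p}\|f\|_p^p$$ for every $f\in L^p(\mathbb{T})$ and every $t>0$.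
   Context: $\mathbb{T}=\mathbb{R}/2\pi\mathbb{Z}$ is the unit circle, with points represented by $[-\pi,\pi]$ (endpoints identified), Lebesgue measure $dt$ (the measure of a set $E$ is $|E|$), and $\|\cdot\|_q$ the norm of $L^q(\mathbb{T})$; $|x-y|$ for $x,y\in\mathbb{T}$ is the distance on the circle. An approximate identity is a family $\{\varphi_r\}_{0<r<1}\subset L^\infty(\mathbb{T})$ such that: ($\Phi1$) $\int_{\mathbb{T}}\varphi_r(t)\,dt\to1$ as $r\to1$; ($\Phi2$) $\varphi_r^*(x):=\sup_{|x|\le|t|\le\pi}|\varphi_r(t)|\to0$ as $r\to1$ for every $0<|x|\le\pi$; ($\Phi3$) $C_\varphi:=\sup_{0<r<1}\|\varphi_r^*\|_1<\infty$. Put $\varphi_*(r)=\sup_{x\in\mathbb{T}}|x\,\varphi_r^*(x)|$ and $\Phi_r(x,f)=\int_{\mathbb{T}}\varphi_r(x-t)f(t)\,dt$. The maximal operator is $$\Phi_\lambda^*(x,f)=\sup_{\substack{|x-y|<\lambda(r)\\0<r<1}}|\Phi_r(y,f)|,$$ the supremum being over all pairs $(y,r)\in\mathbb{T}\times(0,1)$ with $|x-y|<\lambda(r)$. For $g\in L^1(\mathbb{T})$, $Mg(x)=\sup_{0<t<\pi}\frac1{2t}\int_{x-t}^{x+t}|g(u)|\,du$ is the Hardy–Littlewood maximal function; $M|f|^p$ denotes $M$ applied to the function $|f|^p$. *)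

theory Defs
  imports "HOL-Analysis.Analysis" "HOL-Probability.Essential_Supremum"
begin

text \<open>
  The circle is represented by the interval \<open>[-\<pi>, \<pi>]\<close> (the endpoints form a null set), and
  functions on it by \<open>2\<pi>\<close>-periodic functions on the real line. Norms, suprema and maximal
  functions are \<^typ>\<open>ennreal\<close>-valued, so that no supremum or integral is silently truncated.
\<close>

abbreviation circle :: "real set" where
  "circle \<equiv> {-pi..pi}"

abbreviation circle_measure :: "real measure" where
  "circle_measure \<equiv> lebesgue_on circle"

definition circle_dist :: "real \<Rightarrow> real \<Rightarrow> real" where
  "circle_dist x y = (INF k::int. \<bar>x - y + 2 * pi * of_int k\<bar>)"

text \<open>
  By periodicity, measurability on the whole line is the same as measurability on \<open>[-\<pi>, \<pi>]\<close>.
\<close>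

definition circle_fun :: "(real \<Rightarrow> complex) \<Rightarrow> bool" where
  "circle_fun f \<longleftrightarrow> (\<forall>x. f (x + 2 * pi) = f x) \<and> f \<in> borel_measurable lebesgue"

text \<open>
  Powers with exponent \<open>a \<ge> 0\<close> of extended nonnegative numbers. The case \<open>a = 0\<close> is separate
  because \<open>0 powr 0 = 0\<close> for reals, whereas the exponent \<open>p - 1\<close> below must give \<open>1\<close> for \<open>p = 1\<close>.
\<close>

definition epow :: "ennreal \<Rightarrow> real \<Rightarrow> ennreal" where
  "epow u a = (if a = 0 then 1 else if u = top then top else ennreal (enn2real u powr a))"

definition Lp_norm :: "real \<Rightarrow> (real \<Rightarrow> complex) \<Rightarrow> ennreal" where
  "Lp_norm p f = epow (\<integral>\<^sup>+ t. ennreal (norm (f t) powr p) \<partial>circle_measure) (1 / p)"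

definition Linf_norm :: "(real \<Rightarrow> complex) \<Rightarrow> ennreal" where
  "Linf_norm f = esssup circle_measure (\<lambda>t. ennreal (norm (f t)))"

definition Lp :: "real \<Rightarrow> (real \<Rightarrow> complex) set" where
  "Lp p = {f. circle_fun f \<and> Lp_norm p f < top}"

definition Linf :: "(real \<Rightarrow> complex) set" where
  "Linf = {f. circle_fun f \<and> Linf_norm f < top}"

definition radial_majorant :: "(real \<Rightarrow> complex) \<Rightarrow> real \<Rightarrow> ennreal" where
  "radial_majorant k x = (SUP t\<in>{t. \<bar>x\<bar> \<le> \<bar>t\<bar> \<and> \<bar>t\<bar> \<le> pi}. ennreal (norm (k t)))"

definition approximate_identity :: "(real \<Rightarrow> real \<Rightarrow> complex) \<Rightarrow> bool" where
  "approximate_identity \<phi> \<longleftrightarrow>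
     (\<forall>r\<in>{0<..<1}. \<phi> r \<in> Linf) \<and>
     ((\<lambda>r. LINT t|circle_measure. \<phi> r t) \<longlongrightarrow> 1) (at_left 1) \<and>
     (\<forall>x. 0 < \<bar>x\<bar> \<and> \<bar>x\<bar> \<le> pi \<longrightarrow> ((\<lambda>r. radial_majorant (\<phi> r) x) \<longlongrightarrow> 0) (at_left 1)) \<and>
     (SUP r\<in>{0<..<1}. \<integral>\<^sup>+ x. radial_majorant (\<phi> r) x \<partial>circle_measure) < top"

text \<open>The quantity \<open>\<phi>\<^sub>*(r)\<close>, for the kernel \<open>k = \<phi>\<^sub>r\<close>.\<close>

definition phi_star :: "(real \<Rightarrow> complex) \<Rightarrow> ennreal" where
  "phi_star k = (SUP x\<in>circle. ennreal \<bar>x\<bar> * radial_majorant k x)"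

definition Pi_tilde :: "real \<Rightarrow> (real \<Rightarrow> real) \<Rightarrow> (real \<Rightarrow> real \<Rightarrow> complex) \<Rightarrow> ennreal" where
  "Pi_tilde p lam \<phi> =
     (SUP r\<in>{0<..<1}. ennreal (lam r) * Linf_norm (\<phi> r) * epow (phi_star (\<phi> r)) (p - 1))"

definition circle_conv :: "(real \<Rightarrow> complex) \<Rightarrow> (real \<Rightarrow> complex) \<Rightarrow> real \<Rightarrow> complex" where
  "circle_conv k f x = (LINT t|circle_measure. k (x - t) * f t)"

definition Phi_max ::
  "(real \<Rightarrow> real \<Rightarrow> complex) \<Rightarrow> (real \<Rightarrow> real) \<Rightarrow> (real \<Rightarrow> complex) \<Rightarrow> real \<Rightarrow> ennreal" where
  "Phi_max \<phi> lam f x =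
     (SUP (y, r)\<in>{(y, r). y \<in> circle \<and> 0 < r \<and> r < 1 \<and> circle_dist x y < lam r}.
        ennreal (norm (circle_conv (\<phi> r) f y)))"

definition HL_max :: "(real \<Rightarrow> real) \<Rightarrow> real \<Rightarrow> ennreal" where
  "HL_max g x =
     (SUP t\<in>{0<..<pi}. ennreal (1 / (2 * t)) * (\<integral>\<^sup>+ u\<in>{x - t..x + t}. ennreal \<bar>g u\<bar> \<partial>lebesgue))"

end

theory Submission
  imports Defs "HOL-Real_Asymp.Real_Asymp"
begin

text \<open>
  The value of \<open>\<Phi>\<^sub>r(y, f)\<close> at a point \<open>y\<close> with \<open>\<bar>x - y\<bar> \<le> D \<le> \<lambda>(r)\<close> splits into the contributions of
  \<open>\<bar>u - y\<bar> > D\<close> and of \<open>\<bar>u - y\<bar> \<le> D\<close>. Write \<open>M\<close> for \<open>M|f|\<^sup>p(x)\<close>.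

  Far from \<open>y\<close> the displacement of \<open>y\<close> from \<open>x\<close> is harmless: an interval around \<open>y\<close> of radius
  \<open>a > D\<close> lies in the interval of radius \<open>2a\<close> around \<open>x\<close>, so the averages of \<open>|f|\<^sup>p\<close> over it are
  \<open>O(M)\<close>. The kernel is dominated there by its radially decreasing majorant, a superposition of
  indicators of centred intervals with total mass at most \<open>C\<^sub>\<phi>\<close>
  (\<open>nn_integral_radial_kernel_le\<close>).

  Near \<open>y\<close> the kernel satisfies \<open>|\<phi>\<^sub>r(t)| \<le> \<kappa>(t) = min A (B / |t|)\<close>, where \<open>A = \<parallel>\<phi>\<^sub>r\<parallel>\<^sub>\<infinity>\<close> and
  \<open>B = \<phi>\<^sub>*(r)\<close>. For the conjugate exponent \<open>q = p/(p - 1)\<close> the integral of \<open>\<kappa>\<^sup>q\<close> is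
  at most a constant times \<open>A\<^sup>q\<^sup>-\<^sup>1 B\<close>, so Hoelder's inequality on \<open>[y - D, y + D]\<close>
  leads to the quantity \<open>(D A B\<^sup>p\<^sup>-\<^sup>1 M)\<^sup>1\<^sup>/\<^sup>p\<close>, and \<open>D A B\<^sup>p\<^sup>-\<^sup>1\<close> is bounded by
  the hypothesis on \<open>\<lambda>\<close>. For \<open>p = 1\<close> the bound \<open>|\<phi>\<^sub>r| \<le> A\<close> alone suffices.

  In both parts Hoelder's inequality is replaced by the pointwise estimate
  \<open>a \<le> w + w\<^sup>1\<^sup>-\<^sup>p a\<^sup>p\<close> for a weight \<open>w > 0\<close> adapted to the kernel. It is applied at every level
  \<open>\<mu> > 0\<close> with \<open>M \<le> \<mu>\<^sup>p\<close>; letting \<open>\<mu>\<close> decrease to \<open>M\<^sup>1\<^sup>/\<^sup>p\<close> at the end also covers \<open>M = 0\<close>.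
  The weak type estimate then follows from that of the Hardy--Littlewood maximal function, which is
  a consequence of Vitali's covering lemma (\<open>HL_max_weak_type\<close>).
\<close>


section \<open>Lebesgue integrals under translation and reflection\<close>

lemma nn_integral_linear_combination:
  fixes a b :: ennreal
  assumes [measurable]: "f \<in> borel_measurable M" "g \<in> borel_measurable M"
  shows "(\<integral>\<^sup>+u. a * f u + b * g u \<partial>M) = a * (\<integral>\<^sup>+u. f u \<partial>M) + b * (\<integral>\<^sup>+u. g u \<partial>M)"
proof -
  have "(\<integral>\<^sup>+u. a * f u + b * g u \<partial>M) = (\<integral>\<^sup>+u. a * f u \<partial>M) + (\<integral>\<^sup>+u. b * g u \<partial>M)"
    by (rule nn_integral_add) measurable
  then show ?thesis by (simp only: nn_integral_cmult assms)
qed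

lemma nn_integral_translate_lebesgue:
  fixes h :: "real \<Rightarrow> ennreal"
  assumes "h \<in> borel_measurable lebesgue"
  shows "(\<integral>\<^sup>+x. h (x + c) \<partial>lebesgue) = (\<integral>\<^sup>+x. h x \<partial>lebesgue)"
  using nn_integral_real_affine_lebesgue[OF assms, of 1 c] by (simp add: add.commute)

lemma borel_measurable_lebesgue_reflect:
  fixes k :: "real \<Rightarrow> 'a::topological_space"
  assumes "k \<in> borel_measurable lebesgue"
  shows "(\<lambda>u. k (y - u)) \<in> borel_measurable lebesgue"
proof -
  have "(\<lambda>u. y + (-1) * u) \<in> lebesgue \<rightarrow>\<^sub>M lebesgue"
    using lebesgue_affine_measurable[of "\<lambda>_. -1" y] by simp
  from measurable_compose[OF this assms] show ?thesis by simp
qed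

lemma AE_lebesgue_reflect:
  assumes "AE v in lebesgue. P v"
  shows "AE u in lebesgue. P (y - u :: real)"
proof -
  let ?D = "distr lebesgue lebesgue (\<lambda>u. y + (-1) * u)"
  have eq: "lebesgue = density ?D (\<lambda>_. ennreal \<bar>-1\<bar>)"
    by (rule lebesgue_real_affine) simp
  have "AE v in density ?D (\<lambda>_. ennreal \<bar>-1\<bar>). P v"
    by (rule subst[OF eq, where P = "\<lambda>M. AE v in M. P v"]) (rule assms)
  moreover have "(\<lambda>_. ennreal \<bar>-1\<bar>) \<in> borel_measurable ?D"
    by simp
  ultimately have "AE v in ?D. 0 < ennreal \<bar>-1\<bar> \<longrightarrow> P v"
    by (rule AE_density[THEN iffD1, rotated])
  moreover have "(\<lambda>u. y + (-1) * u) \<in> lebesgue \<rightarrow>\<^sub>M lebesgue"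
    using lebesgue_affine_measurable[of "\<lambda>_. -1" y] by simp
  ultimately have "AE u in lebesgue. 0 < ennreal \<bar>-1\<bar> \<longrightarrow> P (y + (-1) * u)"
    by (rule AE_distrD[rotated])
  then show ?thesis by simp
qed


section \<open>Windows of periodic functions and the maximal function\<close>

lemma nn_integral_circle:
  "(\<integral>\<^sup>+t. h t \<partial>circle_measure) = (\<integral>\<^sup>+t\<in>{-pi..pi}. h t \<partial>lebesgue)"
  by (rule nn_integral_restrict_space) simp

text \<open>
  Three consecutive periods cover the long window. This crude form is what allows integrals over the
  circle to be recentred: any window of one period whose centre is within \<open>2\<pi>\<close> of \<open>a\<close> lies in
  \<open>[a - 3\<pi>, a + 3\<pi>]\<close>.
\<close>

lemma periodic_window_le:
  fixes h :: "real \<Rightarrow> ennreal"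
  assumes [measurable]: "h \<in> borel_measurable lebesgue"
    and per: "\<And>x. h (x + 2 * pi) = h x"
  shows "(\<integral>\<^sup>+x\<in>{a - 3 * pi..a + 3 * pi}. h x \<partial>lebesgue)
    \<le> 3 * (\<integral>\<^sup>+x\<in>{a - pi..a + pi}. h x \<partial>lebesgue)"
proof -
  let ?I = "\<lambda>b. \<integral>\<^sup>+x\<in>{b - pi..b + pi}. h x \<partial>lebesgue"
  have meas: "(\<lambda>x. h x * indicator {b..c} x) \<in> borel_measurable lebesgue" for b c
    by (intro borel_measurable_times_ennreal borel_measurable_indicator assms(1)) simp
  have step: "?I (b + 2 * pi) = ?I b" for b
  proof -
    have "?I (b + 2 * pi) =
        (\<integral>\<^sup>+x. h (x + 2 * pi) * indicator {b + 2 * pi - pi..b + 2 * pi + pi} (x + 2 * pi) \<partial>lebesgue)"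
      using nn_integral_translate_lebesgue[OF meas[of "b + 2 * pi - pi" "b + 2 * pi + pi"],
          where c = "2 * pi"]
      by (simp only:)
    also have "\<dots> = ?I b"
      by (intro nn_integral_cong) (auto simp: per indicator_def)
    finally show ?thesis .
  qed
  have "(\<integral>\<^sup>+x\<in>{a - 3 * pi..a + 3 * pi}. h x \<partial>lebesgue)
      \<le> (\<integral>\<^sup>+x. (h x * indicator {a - 2 * pi - pi..a - 2 * pi + pi} x
           + h x * indicator {a - pi..a + pi} x)
           + h x * indicator {a + 2 * pi - pi..a + 2 * pi + pi} x \<partial>lebesgue)"
    by (intro nn_integral_mono) (auto simp: indicator_def)
  also have "\<dots> = ?I (a - 2 * pi) + ?I a + ?I (a + 2 * pi)"
    by (simp only: nn_integral_add[OF borel_measurable_add[OF meas meas] meas]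
        nn_integral_add[OF meas meas])
  also have "\<dots> = 3 * ?I a"
  proof -
    have three: "e + e + e = 3 * e" for e :: ennreal
      using distrib_right[of 2 1 e] by (simp add: mult_2)
    show ?thesis
      using step[of a] step[of "a - 2 * pi"] by (simp add: three)
  qed
  finally show ?thesis .
qed

lemma window_le_HL_max:
  fixes g :: "real \<Rightarrow> real"
  assumes "0 < t" "t < pi"
  shows "(\<integral>\<^sup>+u\<in>{x - t..x + t}. ennreal \<bar>g u\<bar> \<partial>lebesgue) \<le> ennreal (2 * t) * HL_max g x"
proof -
  let ?I = "\<integral>\<^sup>+u\<in>{x - t..x + t}. ennreal \<bar>g u\<bar> \<partial>lebesgue"
  have "ennreal (1 / (2 * t)) * ?I \<le> HL_max g x"
    unfolding HL_max_def using assms by (intro SUP_upper2[of t]) auto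
  then have "ennreal (2 * t) * (ennreal (1 / (2 * t)) * ?I) \<le> ennreal (2 * t) * HL_max g x"
    by (intro mult_left_mono) auto
  moreover have "ennreal (2 * t) * (ennreal (1 / (2 * t)) * ?I) = ?I"
    using assms by (simp add: mult.assoc[symmetric] ennreal_mult[symmetric])
  ultimately show ?thesis by simp
qed

text \<open>
  The maximal function only averages over radii \<open>t < \<pi>\<close>, and such windows miss the antipode of
  \<open>x\<close>, so a whole period is reached by monotone convergence \<open>t \<rightarrow> \<pi>\<close>.
\<close>

lemma period_le_HL_max:
  fixes g :: "real \<Rightarrow> real"
  assumes [measurable]: "g \<in> borel_measurable lebesgue"
  shows "(\<integral>\<^sup>+u\<in>{x - pi..x + pi}. ennreal \<bar>g u\<bar> \<partial>lebesgue) \<le> ennreal (2 * pi) * HL_max g x"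
proof -
  define t where "t n = pi * (1 - 1 / (real n + 2))" for n
  have t: "0 < t n" "t n < pi" for n
    unfolding t_def by (auto simp: field_simps intro!: add_pos_nonneg)
  let ?N = "density lebesgue (\<lambda>u. ennreal \<bar>g u\<bar>)"
  let ?A = "\<lambda>n. {x - t n..x + t n}"
  have tmono: "t m \<le> t n" if "m \<le> n" for m n
    unfolding t_def using that by (intro mult_left_mono diff_left_mono divide_left_mono) auto
  have tlim: "t \<longlonglongrightarrow> pi"
    unfolding t_def by real_asymp
  have union: "(\<Union>n. ?A n) = {x - pi<..<x + pi}"
  proof
    show "(\<Union>n. ?A n) \<subseteq> {x - pi<..<x + pi}"
    proof
      fix u assume "u \<in> (\<Union>n. ?A n)"
      then obtain n where "u \<in> ?A n" by auto
      with t(2)[of n] show "u \<in> {x - pi<..<x + pi}" by auto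
    qed
    show "{x - pi<..<x + pi} \<subseteq> (\<Union>n. ?A n)"
    proof
      fix u assume "u \<in> {x - pi<..<x + pi}"
      then have "\<bar>u - x\<bar> < pi" by auto
      then obtain n where "\<bar>u - x\<bar> < t n"
        using order_tendstoD(1)[OF tlim] by (metis eventually_sequentially order_refl)
      then show "u \<in> (\<Union>n. ?A n)" by (auto intro!: exI[of _ n])
    qed
  qed
  have "(\<integral>\<^sup>+u\<in>{x - pi..x + pi}. ennreal \<bar>g u\<bar> \<partial>lebesgue)
      = (\<integral>\<^sup>+u\<in>{x - pi<..<x + pi}. ennreal \<bar>g u\<bar> \<partial>lebesgue)"
  proof (rule nn_integral_cong_AE)
    have "AE u in lebesgue. u \<notin> {x - pi, x + pi}"
      by (intro AE_not_in negligible_iff_null_sets[THEN iffD1] negligible_finite) auto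
    then show "AE u in lebesgue. ennreal \<bar>g u\<bar> * indicator {x - pi..x + pi} u
        = ennreal \<bar>g u\<bar> * indicator {x - pi<..<x + pi} u"
      by eventually_elim (auto simp: indicator_def)
  qed
  also have "\<dots> = emeasure ?N (\<Union>n. ?A n)"
    unfolding union by (subst emeasure_density) auto
  also have "\<dots> = (SUP n. emeasure ?N (?A n))"
  proof (rule SUP_emeasure_incseq[symmetric])
    show "incseq ?A"
      using tmono by (fastforce simp: incseq_def intro: order_trans)
  qed auto
  also have "\<dots> \<le> ennreal (2 * pi) * HL_max g x"
  proof (rule SUP_least)
    fix n
    have "emeasure ?N (?A n) \<le> ennreal (2 * t n) * HL_max g x"
      using window_le_HL_max[of "t n" g x] t[of n] by (simp add: emeasure_density)
    also have "\<dots> \<le> ennreal (2 * pi) * HL_max g x"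
      using t[of n] by (intro mult_right_mono ennreal_leI) auto
    finally show "emeasure ?N (?A n) \<le> ennreal (2 * pi) * HL_max g x" .
  qed
  finally show ?thesis .
qed

text \<open>
  Windows longer than a period occur when an interval of radius up to \<open>\<pi>\<close> around a nearby point is
  enlarged to one around \<open>x\<close>; periodicity reduces them to a single period, at the cost of
  replacing the factor \<open>2 s\<close> by \<open>6 s\<close>.
\<close>

lemma periodic_window_le_HL_max:
  fixes g :: "real \<Rightarrow> real"
  assumes [measurable]: "g \<in> borel_measurable lebesgue"
    and per: "\<And>x. g (x + 2 * pi) = g x"
    and s: "0 < s" "s \<le> 3 * pi"
  shows "(\<integral>\<^sup>+u\<in>{x - s..x + s}. ennreal \<bar>g u\<bar> \<partial>lebesgue) \<le> ennreal (6 * s) * HL_max g x"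
proof (cases "s < pi")
  case True
  have "(\<integral>\<^sup>+u\<in>{x - s..x + s}. ennreal \<bar>g u\<bar> \<partial>lebesgue) \<le> ennreal (2 * s) * HL_max g x"
    using s True by (intro window_le_HL_max) auto
  also have "\<dots> \<le> ennreal (6 * s) * HL_max g x"
    using s by (intro mult_right_mono ennreal_leI) auto
  finally show ?thesis .
next
  case False
  have "(\<integral>\<^sup>+u\<in>{x - s..x + s}. ennreal \<bar>g u\<bar> \<partial>lebesgue)
      \<le> (\<integral>\<^sup>+u\<in>{x - 3 * pi..x + 3 * pi}. ennreal \<bar>g u\<bar> \<partial>lebesgue)"
    using s by (intro nn_integral_mono) (auto simp: indicator_def)
  also have "\<dots> \<le> 3 * (\<integral>\<^sup>+u\<in>{x - pi..x + pi}. ennreal \<bar>g u\<bar> \<partial>lebesgue)"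
    by (rule periodic_window_le) (auto simp: per)
  also have "\<dots> \<le> 3 * (ennreal (2 * pi) * HL_max g x)"
    by (intro mult_left_mono period_le_HL_max) auto
  also have "\<dots> = ennreal (6 * pi) * HL_max g x"
    using ennreal_mult'[of 3 "2 * pi"] by (simp add: mult.assoc[symmetric])
  also have "\<dots> \<le> ennreal (6 * s) * HL_max g x"
    using False by (intro mult_right_mono ennreal_leI) auto
  finally show ?thesis .
qed


section \<open>The weak type estimate for the Hardy--Littlewood maximal function\<close>

text \<open>
  Every point of \<open>S\<close> is the centre of an interval on which \<open>|g|\<close> has mass at least \<open>s\<close> times
  the length. Vitali's lemma selects disjoint ones whose fivefold enlargements still cover \<open>S\<close>.
  Since the radii are below \<open>\<pi>\<close>, the selected intervals stay within \<open>[-2\<pi>, 2\<pi>]\<close>, hence within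
  three periods; this gives the constant \<open>5 \<cdot> 3\<close>.
\<close>

lemma HL_max_weak_type:
  fixes g :: "real \<Rightarrow> real"
  assumes g[measurable]: "g \<in> borel_measurable lebesgue"
    and per: "\<And>x. g (x + 2 * pi) = g x"
    and S: "S \<subseteq> circle" and s: "0 < s"
    and HL: "\<And>x. x \<in> S \<Longrightarrow> ennreal s < HL_max g x"
  shows "ennreal s * emeasure lebesgue S \<le> 15 * (\<integral>\<^sup>+u. ennreal \<bar>g u\<bar> \<partial>circle_measure)"
proof (cases "S \<in> sets lebesgue")
  case False
  then show ?thesis by (simp add: emeasure_notin_sets)
next
  case True
  let ?\<nu> = "density lebesgue (\<lambda>u. ennreal \<bar>g u\<bar>)"
  have \<nu>: "emeasure ?\<nu> A = (\<integral>\<^sup>+u\<in>A. ennreal \<bar>g u\<bar> \<partial>lebesgue)" if "A \<in> sets lebesgue" for A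
    using that by (subst emeasure_density) auto
  have "\<exists>t. 0 < t \<and> t < pi \<and> ennreal (2 * t * s) \<le> emeasure ?\<nu> {x - t..x + t}" if "x \<in> S" for x
  proof -
    from HL[OF that] obtain t where t: "0 < t" "t < pi"
      "ennreal s < ennreal (1 / (2 * t)) * (\<integral>\<^sup>+u\<in>{x - t..x + t}. ennreal \<bar>g u\<bar> \<partial>lebesgue)"
      unfolding HL_max_def less_SUP_iff by auto
    have "ennreal (2 * t * s) = ennreal (2 * t) * ennreal s"
      using t s by (simp add: ennreal_mult)
    also have "\<dots> \<le> ennreal (2 * t) * (ennreal (1 / (2 * t)) * (\<integral>\<^sup>+u\<in>{x - t..x + t}. ennreal \<bar>g u\<bar> \<partial>lebesgue))"
      using t by (intro mult_left_mono less_imp_le) auto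
    also have "\<dots> = emeasure ?\<nu> {x - t..x + t}"
      using t by (simp add: \<nu> mult.assoc[symmetric] ennreal_mult[symmetric])
    finally show ?thesis using t by blast
  qed
  then obtain \<tau> where \<tau>: "0 < \<tau> x" "\<tau> x < pi" "ennreal (2 * \<tau> x * s) \<le> emeasure ?\<nu> {x - \<tau> x..x + \<tau> x}"
    if "x \<in> S" for x
    by metis
  obtain C where C: "countable C" "C \<subseteq> S"
    "pairwise (\<lambda>i j. disjnt (cball i (\<tau> i)) (cball j (\<tau> j))) C"
    "S \<subseteq> (\<Union>i\<in>C. cball i (5 * \<tau> i))"
  proof (rule Vitali_covering_lemma_cballs[where S = S and K = S and a = "\<lambda>x. x" and r = \<tau> and B = pi])
    show "S \<subseteq> (\<Union>i\<in>S. cball i (\<tau> i))"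
      using \<tau>(1) by (force intro: less_imp_le)
    show "0 < \<tau> i \<and> \<tau> i \<le> pi" if "i \<in> S" for i
      using \<tau>[OF that] by simp
  qed (use that in blast)
  \<comment> \<open>The selected family may be finite; padding with empty sets turns it into a sequence that is
    disjoint without repetitions.\<close>
  define J where "J = to_nat_on C ` C"
  define c where "c = from_nat_into C"
  define E where "E n = (if n \<in> J then cball (c n) (5 * \<tau> (c n)) else {})" for n
  define F where "F n = (if n \<in> J then cball (c n) (\<tau> (c n)) else {})" for n
  have cJ: "c n \<in> S" if "n \<in> J" for n
    using that C by (auto simp: J_def c_def from_nat_into_to_nat_on)
  have inj: "c n \<noteq> c m" if "n \<in> J" "m \<in> J" "n \<noteq> m" for n m
    using that C(1) by (auto simp: J_def c_def)
  have cC: "c n \<in> C" if "n \<in> J" for n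
    using that C(1) by (auto simp: J_def c_def)
  have SE: "S \<subseteq> (\<Union>n. E n)"
  proof
    fix x assume "x \<in> S"
    then obtain i where i: "i \<in> C" "x \<in> cball i (5 * \<tau> i)" using C(4) by blast
    then have "x \<in> E (to_nat_on C i)"
      using C(1) by (simp add: E_def J_def c_def)
    then show "x \<in> (\<Union>n. E n)" by blast
  qed
  have disj: "disjoint_family F"
    unfolding disjoint_family_on_def F_def
    using C(3) cC inj by (auto simp: pairwise_def disjnt_def)
  have F_sub: "F n \<subseteq> {- (2 * pi)..2 * pi}" for n
  proof (cases "n \<in> J")
    case True
    then have "c n \<in> circle" "\<tau> (c n) < pi" using subsetD[OF S cJ] \<tau>(2)[OF cJ] by blast+
    then show ?thesis using True by (auto simp: F_def cball_eq_atLeastAtMost)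
  qed (simp add: F_def)
  have cell: "ennreal s * emeasure lebesgue (E n) \<le> 5 * emeasure ?\<nu> (F n)" for n
  proof (cases "n \<in> J")
    case True
    note t = \<tau>[OF cJ[OF True]]
    have "ennreal s * emeasure lebesgue (E n) = ennreal s * ennreal (10 * \<tau> (c n))"
      using True t by (simp add: E_def cball_eq_atLeastAtMost)
    also have "\<dots> = 5 * ennreal (2 * \<tau> (c n) * s)"
      using s t ennreal_mult'[of 5 "2 * \<tau> (c n) * s"] by (simp add: ennreal_mult[symmetric] mult_ac)
    also have "\<dots> \<le> 5 * emeasure ?\<nu> {c n - \<tau> (c n)..c n + \<tau> (c n)}"
      by (intro mult_left_mono t) simp
    finally show ?thesis using True by (simp add: F_def cball_eq_atLeastAtMost)
  qed (simp add: E_def)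
  have "ennreal s * emeasure lebesgue S \<le> ennreal s * emeasure lebesgue (\<Union>n. E n)"
    using SE by (intro mult_left_mono emeasure_mono) (auto simp: E_def)
  also have "\<dots> \<le> ennreal s * (\<Sum>n. emeasure lebesgue (E n))"
    by (intro mult_left_mono emeasure_subadditive_countably) (auto simp: E_def)
  also have "\<dots> = (\<Sum>n. ennreal s * emeasure lebesgue (E n))"
    by (rule ennreal_suminf_cmult[symmetric])
  also have "\<dots> \<le> (\<Sum>n. 5 * emeasure ?\<nu> (F n))"
    by (intro suminf_le cell summableI)
  also have "\<dots> = 5 * (\<Sum>n. emeasure ?\<nu> (F n))"
    by (rule ennreal_suminf_cmult)
  also have "(\<Sum>n. emeasure ?\<nu> (F n)) = emeasure ?\<nu> (\<Union>n. F n)"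
  proof (rule suminf_emeasure)
    show "range F \<subseteq> sets ?\<nu>" by (auto simp: F_def)
  qed (rule disj)
  also have "5 * \<dots> \<le> 5 * emeasure ?\<nu> {0 - 3 * pi..0 + 3 * pi}"
  proof (intro mult_left_mono emeasure_mono)
    have "(\<Union>n. F n) \<subseteq> {- (2 * pi)..2 * pi}" using F_sub by blast
    also have "\<dots> \<subseteq> {0 - 3 * pi..0 + 3 * pi}" by auto
    finally show "(\<Union>n. F n) \<subseteq> {0 - 3 * pi..0 + 3 * pi}" .
  qed auto
  also have "\<dots> \<le> 5 * (3 * (\<integral>\<^sup>+u\<in>{0 - pi..0 + pi}. ennreal \<bar>g u\<bar> \<partial>lebesgue))"
    unfolding \<nu>[OF lmeasurable_cbox[THEN fmeasurableD, of "0 - 3 * pi" "0 + 3 * pi", simplified cbox_interval]]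
    by (intro mult_left_mono periodic_window_le) (auto simp: per)
  also have "\<dots> = 15 * (\<integral>\<^sup>+u. ennreal \<bar>g u\<bar> \<partial>circle_measure)"
    by (simp add: nn_integral_circle mult.assoc[symmetric])
  finally show ?thesis .
qed


section \<open>Radially decreasing kernels\<close>

text \<open>
  The layer-cake representation of a single value; under the integral sign it decomposes a kernel into
  indicators of its level sets.
\<close>

lemma layer_cake_ennreal:
  fixes k :: ennreal
  shows "(\<integral>\<^sup>+s. indicator {s. 0 < s \<and> ennreal s < k} s \<partial>lborel) = k"
proof (cases k)
  case (real r)
  have "{s. 0 < s \<and> ennreal s < k} = {0<..<r}"
    using real by (auto simp: ennreal_less_iff)
  then show ?thesis using real by simp
next
  case top
  have "ennreal (real n) \<le> emeasure lborel {s::real. 0 < s}" for n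
  proof -
    have "ennreal (real n) = emeasure lborel {0<..<real n}" by simp
    also have "\<dots> \<le> emeasure lborel {s::real. 0 < s}" by (intro emeasure_mono) auto
    finally show ?thesis .
  qed
  then have "emeasure lborel {s::real. 0 < s} = top"
    by (metis ennreal_of_nat_eq_real_of_nat ennreal_Ex_less_of_nat less_top not_le)
  then show ?thesis using top by simp
qed

lemma radial_level_set_interval:
  fixes K :: "real \<Rightarrow> ennreal"
  assumes K: "\<And>s t. \<bar>s\<bar> \<le> \<bar>t\<bar> \<Longrightarrow> K t \<le> K s"
  shows "is_interval {u. l < K u}"
  unfolding is_interval_1
proof (intro ballI allI impI)
  fix p q u assume pq: "p \<in> {u. l < K u}" "q \<in> {u. l < K u}" "p \<le> u \<and> u \<le> q"
  then have "\<bar>u\<bar> \<le> \<bar>p\<bar> \<or> \<bar>u\<bar> \<le> \<bar>q\<bar>" by auto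
  then show "u \<in> {u. l < K u}"
    using K[of u p] K[of u q] pq by (auto intro: less_le_trans)
qed

text \<open>
  A level set of a radially decreasing kernel is, up to its endpoints, a centred interval, so the
  hypothesis on centred intervals applies to it. The bound \<open>b\<close> on the support keeps its radius finite.
\<close>

lemma radial_level_set_le:
  fixes K G :: "real \<Rightarrow> ennreal"
  assumes K: "\<And>s t. \<bar>s\<bar> \<le> \<bar>t\<bar> \<Longrightarrow> K t \<le> K s"
    and bd: "\<And>t. b < \<bar>t\<bar> \<Longrightarrow> K t = 0"
    and G: "\<And>a. 0 < a \<Longrightarrow> (\<integral>\<^sup>+u\<in>{y - a..y + a}. G u \<partial>lebesgue) \<le> c * ennreal (2 * a)"
  shows "(\<integral>\<^sup>+u\<in>{u. l < K (u - y)}. G u \<partial>lebesgue) \<le> c * emeasure lebesgue {u. l < K u}"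
proof (cases "\<forall>u. l < K u \<longrightarrow> u = 0")
  case True
  have "AE u in lebesgue. u \<noteq> y"
    using AE_not_in[of "{y}" lebesgue] by (simp add: negligible_iff_null_sets[symmetric])
  then have "AE u in lebesgue. G u * indicator {u. l < K (u - y)} u = 0"
    by eventually_elim (use True in \<open>auto simp: indicator_def\<close>)
  then have "(\<integral>\<^sup>+u\<in>{u. l < K (u - y)}. G u \<partial>lebesgue) = (\<integral>\<^sup>+(u::real). 0 \<partial>lebesgue)"
    by (rule nn_integral_cong_AE)
  then show ?thesis by simp
next
  case False
  define I where "I = abs ` {u. l < K u}"
  have bI: "bdd_above I"
  proof (rule bdd_aboveI)
    fix v assume "v \<in> I"
    then obtain u where "v = \<bar>u\<bar>" "l < K u" by (auto simp: I_def)
    then show "v \<le> b" using bd[of u] by (cases "b < v") auto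
  qed
  define a where "a = Sup I"
  obtain u0 where u0: "l < K u0" "u0 \<noteq> 0" using False by auto
  have "\<bar>u0\<bar> \<le> a"
    unfolding a_def using u0 bI by (intro cSup_upper) (auto simp: I_def)
  then have a: "0 < a" using u0 by auto
  have sub: "{u. l < K u} \<subseteq> {-a..a}"
  proof
    fix u assume "u \<in> {u. l < K u}"
    then have "\<bar>u\<bar> \<le> a"
      unfolding a_def using bI by (intro cSup_upper) (auto simp: I_def)
    then show "u \<in> {-a..a}" by auto
  qed
  have sup: "{-a<..<a} \<subseteq> {u. l < K u}"
  proof
    fix u assume "u \<in> {-a<..<a}"
    then have "\<bar>u\<bar> < Sup I" by (auto simp: a_def)
    moreover have "I \<noteq> {}" using u0 by (auto simp: I_def)
    ultimately obtain v where "v \<in> I" "\<bar>u\<bar> < v"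
      using less_cSup_iff[OF _ bI] by blast
    then show "u \<in> {u. l < K u}"
      using K[of u] by (auto simp: I_def intro: less_le_trans)
  qed
  have int: "is_interval {u. l < K u}"
    using K by (rule radial_level_set_interval)
  have "(\<integral>\<^sup>+u\<in>{u. l < K (u - y)}. G u \<partial>lebesgue) \<le> (\<integral>\<^sup>+u\<in>{y - a..y + a}. G u \<partial>lebesgue)"
    using sub by (intro nn_integral_mono) (force simp: indicator_def)
  also have "\<dots> \<le> c * ennreal (2 * a)" by (rule G) fact
  also have "ennreal (2 * a) = emeasure lebesgue {-a<..<a}" using a by simp
  also have "\<dots> \<le> emeasure lebesgue {u. l < K u}"
    using sup real_interval_borel_measurable[OF int] by (intro emeasure_mono) auto
  finally show ?thesis by (simp add: mult_left_mono)
qed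

text \<open>
  The kernel is a superposition of indicators of centred intervals, so an average bound over such
  intervals integrates to a bound against the kernel. As \<open>G\<close> is only Lebesgue measurable, it is replaced
  by a Borel function before Tonelli's theorem is applied.
\<close>

lemma nn_integral_radial_kernel_le:
  fixes K G :: "real \<Rightarrow> ennreal"
  assumes K: "\<And>s t. \<bar>s\<bar> \<le> \<bar>t\<bar> \<Longrightarrow> K t \<le> K s"
    and bd: "\<And>t. b < \<bar>t\<bar> \<Longrightarrow> K t = 0"
    and meas: "G \<in> borel_measurable lebesgue"
    and G: "\<And>a. 0 < a \<Longrightarrow> (\<integral>\<^sup>+u\<in>{y - a..y + a}. G u \<partial>lebesgue) \<le> c * ennreal (2 * a)"
  shows "(\<integral>\<^sup>+u. K (u - y) * G u \<partial>lebesgue) \<le> c * (\<integral>\<^sup>+u. K u \<partial>lebesgue)"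
proof -
  have int: "is_interval {u. l < K u}" for l
    using K by (rule radial_level_set_interval)
  have Km[measurable]: "K \<in> borel_measurable borel"
    using real_interval_borel_measurable[OF int] by (intro borel_measurableI_greater) auto
  obtain G' where G'[measurable]: "G' \<in> borel_measurable lborel"
    and ae: "AE u in lborel. G u = G' u"
    using completion_ex_borel_measurable[OF meas] by auto
  let ?L = "\<lambda>s u::real. indicator {s. 0 < s \<and> ennreal s < K (u - y)} s :: ennreal"
  have "(\<integral>\<^sup>+u. K (u - y) * G u \<partial>lebesgue) = (\<integral>\<^sup>+u. K (u - y) * G' u \<partial>lborel)"
    using ae by (subst nn_integral_completion) (auto intro!: nn_integral_cong_AE elim!: eventually_mono)
  also have "\<dots> = (\<integral>\<^sup>+u. (\<integral>\<^sup>+s. ?L s u * G' u \<partial>lborel) \<partial>lborel)"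
    by (subst nn_integral_multc) (simp_all only: layer_cake_ennreal, simp_all)
  also have "\<dots> = (\<integral>\<^sup>+s. (\<integral>\<^sup>+u. ?L s u * G' u \<partial>lborel) \<partial>lborel)"
    by (rule lborel_pair.Fubini') measurable
  also have "\<dots> \<le> (\<integral>\<^sup>+s. c * (\<integral>\<^sup>+u. indicator {s. 0 < s \<and> ennreal s < K u} s \<partial>lborel) \<partial>lborel)"
  proof (rule nn_integral_mono)
    fix s :: real
    show "(\<integral>\<^sup>+u. ?L s u * G' u \<partial>lborel)
      \<le> c * (\<integral>\<^sup>+u. indicator {s. 0 < s \<and> ennreal s < K u} s \<partial>lborel)"
    proof (cases "0 < s")
      case True
      have "(\<integral>\<^sup>+u. ?L s u * G' u \<partial>lborel)
          = (\<integral>\<^sup>+u\<in>{u. ennreal s < K (u - y)}. G u \<partial>lebesgue)"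
        using ae by (subst nn_integral_completion)
          (auto intro!: nn_integral_cong_AE elim!: eventually_mono simp: indicator_def True)
      also have "\<dots> \<le> c * emeasure lebesgue {u. ennreal s < K u}"
        using K bd G by (rule radial_level_set_le)
      also have "emeasure lebesgue {u. ennreal s < K u}
          = (\<integral>\<^sup>+u. indicator {u. ennreal s < K u} u \<partial>lborel)"
        by (subst nn_integral_indicator) auto
      also have "\<dots> = (\<integral>\<^sup>+u. indicator {s. 0 < s \<and> ennreal s < K u} s \<partial>lborel)"
        using True by (intro nn_integral_cong) (simp add: indicator_def)
      finally show ?thesis .
    qed simp
  qed
  also have "\<dots> = c * (\<integral>\<^sup>+s. (\<integral>\<^sup>+u. indicator {s. 0 < s \<and> ennreal s < K u} s \<partial>lborel) \<partial>lborel)"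
    by (rule nn_integral_cmult) measurable
  also have "(\<integral>\<^sup>+s. (\<integral>\<^sup>+u. indicator {s. 0 < s \<and> ennreal s < K u} s \<partial>lborel) \<partial>lborel)
      = (\<integral>\<^sup>+u. (\<integral>\<^sup>+s. indicator {s. 0 < s \<and> ennreal s < K u} s \<partial>lborel) \<partial>lborel)"
    by (rule lborel_pair.Fubini') measurable
  also have "\<dots> = (\<integral>\<^sup>+u. K u \<partial>lebesgue)"
    by (simp only: layer_cake_ennreal nn_integral_completion)
  finally show ?thesis .
qed


section \<open>The majorant and the norms of a kernel\<close>

lemma radial_majorant_mono: "\<bar>s\<bar> \<le> \<bar>t\<bar> \<Longrightarrow> radial_majorant k t \<le> radial_majorant k s"
  unfolding radial_majorant_def by (intro SUP_subset_mono) auto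

lemma radial_majorant_eq_0: "pi < \<bar>t\<bar> \<Longrightarrow> radial_majorant k t = 0"
proof -
  assume "pi < \<bar>t\<bar>"
  then have "{s. \<bar>t\<bar> \<le> \<bar>s\<bar> \<and> \<bar>s\<bar> \<le> pi} = {}" by auto
  then show ?thesis unfolding radial_majorant_def by (simp only: SUP_empty bot_ennreal)
qed

lemma norm_le_radial_majorant: "\<bar>t\<bar> \<le> pi \<Longrightarrow> ennreal (norm (k t)) \<le> radial_majorant k t"
  unfolding radial_majorant_def by (intro SUP_upper) auto

lemma nn_integral_radial_majorant:
  "(\<integral>\<^sup>+t. radial_majorant k t \<partial>lebesgue) = (\<integral>\<^sup>+t. radial_majorant k t \<partial>circle_measure)"
  unfolding nn_integral_circle
  by (intro nn_integral_cong) (auto simp: indicator_def radial_majorant_eq_0 abs_if)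

lemma AE_norm_le_Linf_norm:
  assumes "Linf_norm k = ennreal A" "0 \<le> A"
  shows "AE u in lebesgue. \<bar>u - y\<bar> \<le> pi \<longrightarrow> norm (k (y - u)) \<le> A"
proof -
  have "AE v in circle_measure. ennreal (norm (k v)) \<le> ennreal A"
    using esssup_AE[where M = circle_measure and f = "\<lambda>v. ennreal (norm (k v))"] assms(1)
    unfolding Linf_norm_def by simp
  then have "AE v in lebesgue. v \<in> circle \<longrightarrow> ennreal (norm (k v)) \<le> ennreal A"
    by (subst (asm) AE_restrict_space_iff) auto
  from AE_lebesgue_reflect[OF this, of y] show ?thesis
    by eventually_elim (use \<open>0 \<le> A\<close> in \<open>auto simp: abs_le_iff\<close>)
qed

lemma norm_le_phi_star:
  assumes "phi_star k \<le> ennreal B" "0 \<le> B" "\<bar>t\<bar> \<le> pi"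
  shows "\<bar>t\<bar> * norm (k t) \<le> B"
proof -
  have "ennreal (\<bar>t\<bar> * norm (k t)) = ennreal \<bar>t\<bar> * ennreal (norm (k t))"
    by (simp add: ennreal_mult)
  also have "\<dots> \<le> ennreal \<bar>t\<bar> * radial_majorant k t"
    using assms(3) by (intro mult_left_mono norm_le_radial_majorant) simp_all
  also have "\<dots> \<le> phi_star k"
    unfolding phi_star_def using assms(3) by (intro SUP_upper) auto
  also have "\<dots> \<le> ennreal B" by (rule assms(1))
  finally show ?thesis using assms(2) by simp
qed


section \<open>The part of the kernel away from its centre\<close>

text \<open>
  This substitutes for the inequalities of Jensen and Hoelder: values below the threshold \<open>w\<close>
  are paid for by \<open>w\<close>, larger ones by their \<open>p\<close>-th power. A weight \<open>w\<close> that depends on the point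
  gives weighted estimates.
\<close>

lemma le_add_powr_scaled:
  fixes a w p :: real
  assumes "0 \<le> a" "0 < w" "1 \<le> p"
  shows "a \<le> w + w powr (1 - p) * a powr p"
proof (cases "a \<le> w")
  case False
  then have "a = a powr (1 - p) * a powr p"
    using assms by (simp add: powr_add[symmetric])
  also have "\<dots> \<le> w powr (1 - p) * a powr p"
    using False assms by (intro mult_right_mono powr_mono2') auto
  finally show ?thesis using assms by simp
qed (use assms in \<open>simp add: add_increasing2\<close>)

text \<open>
  The constant weight \<open>w = \<mu>\<close> reduces \<open>|f|\<close> to \<open>\<mu> + \<mu>\<^sup>1\<^sup>-\<^sup>p |f|\<^sup>p\<close>. Restricted to
  \<open>\<bar>u - y\<bar> > D\<close>, the function \<open>|f|\<^sup>p\<close> has no mass in intervals around \<open>y\<close> of radius at most \<open>D\<close>,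
  while larger ones are contained in intervals around \<open>x\<close> of twice the radius. Hence the averages of
  the sum over all intervals centred at \<open>y\<close> are at most \<open>\<mu> + 6\<mu>\<close>.
\<close>

lemma nn_integral_kernel_tail_le:
  fixes f :: "real \<Rightarrow> complex"
  assumes f[measurable]: "f \<in> borel_measurable lebesgue"
    and p: "1 \<le> p" and mu: "0 < \<mu>"
    and xy: "\<bar>x - y\<bar> \<le> D"
    and win: "\<And>s. 0 < s \<Longrightarrow> s \<le> 2 * pi \<Longrightarrow>
      (\<integral>\<^sup>+u\<in>{x - s..x + s}. ennreal (norm (f u) powr p) \<partial>lebesgue) \<le> ennreal (6 * s * \<mu> powr p)"
    and C: "(\<integral>\<^sup>+t. radial_majorant k t \<partial>circle_measure) \<le> ennreal C" "0 \<le> C"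
  shows "(\<integral>\<^sup>+u\<in>{u. D < \<bar>u - y\<bar> \<and> \<bar>u - y\<bar> \<le> pi}. radial_majorant k (u - y) * ennreal (norm (f u)) \<partial>lebesgue)
    \<le> ennreal (7 * \<mu> * C)"
proof -
  let ?S = "{u. D < \<bar>u - y\<bar> \<and> \<bar>u - y\<bar> \<le> pi}"
  let ?c = "ennreal (\<mu> powr (1 - p))"
  let ?P = "\<lambda>u. ennreal (norm (f u) powr p) * indicator ?S u"
  let ?G = "\<lambda>u. ennreal \<mu> + ?c * ?P u"
  have "?S \<in> sets borel" by measurable
  then have [measurable]: "?S \<in> sets lebesgue" by simp
  have Pm: "?P \<in> borel_measurable lebesgue" by measurable
  have winP: "(\<integral>\<^sup>+u\<in>{y - a..y + a}. ?P u \<partial>lebesgue) \<le> ennreal (12 * a * \<mu> powr p)" if a: "0 < a" for a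
  proof (cases "a \<le> D")
    case True
    then have "(\<integral>\<^sup>+u\<in>{y - a..y + a}. ?P u \<partial>lebesgue) = (\<integral>\<^sup>+(u::real). 0 \<partial>lebesgue)"
      by (intro nn_integral_cong) (auto simp: indicator_def)
    then show ?thesis by simp
  next
    case False
    show ?thesis
    proof (cases "D < pi")
      case True
      \<comment> \<open>The integrand vanishes beyond distance \<open>\<pi>\<close> from \<open>y\<close>, so radii above \<open>\<pi>\<close> can be cut down.\<close>
      define s where "s = 2 * min a pi"
      have s: "0 < s" "s \<le> 2 * pi" using a by (auto simp: s_def)
      have "(\<integral>\<^sup>+u\<in>{y - a..y + a}. ?P u \<partial>lebesgue)
          \<le> (\<integral>\<^sup>+u\<in>{x - s..x + s}. ennreal (norm (f u) powr p) \<partial>lebesgue)"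
        using xy False True by (intro nn_integral_mono) (auto simp: indicator_def s_def min_def)
      also have "\<dots> \<le> ennreal (6 * s * \<mu> powr p)" by (rule win[OF s])
      also have "\<dots> \<le> ennreal (12 * a * \<mu> powr p)"
        by (intro ennreal_leI mult_right_mono) (auto simp: s_def)
      finally show ?thesis .
    next
      case False
      then have "(\<integral>\<^sup>+u\<in>{y - a..y + a}. ?P u \<partial>lebesgue) = (\<integral>\<^sup>+(u::real). 0 \<partial>lebesgue)"
        by (intro nn_integral_cong) (auto simp: indicator_def)
      then show ?thesis by simp
    qed
  qed
  have "(\<integral>\<^sup>+u\<in>?S. radial_majorant k (u - y) * ennreal (norm (f u)) \<partial>lebesgue)
      \<le> (\<integral>\<^sup>+u. radial_majorant k (u - y) * ?G u \<partial>lebesgue)"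
  proof (rule nn_integral_mono)
    fix u
    have "ennreal (norm (f u)) \<le> ennreal (\<mu> + \<mu> powr (1 - p) * norm (f u) powr p)"
      using mu p by (intro ennreal_leI le_add_powr_scaled) auto
    then have "ennreal (norm (f u)) \<le> ?G u" if "u \<in> ?S"
      using that mu by (simp add: ennreal_mult)
    then show "radial_majorant k (u - y) * ennreal (norm (f u)) * indicator ?S u
        \<le> radial_majorant k (u - y) * ?G u"
      by (cases "u \<in> ?S") (simp_all add: mult_left_mono)
  qed
  also have "\<dots> \<le> ennreal (7 * \<mu>) * (\<integral>\<^sup>+t. radial_majorant k t \<partial>lebesgue)"
  proof (rule nn_integral_radial_kernel_le[where b = pi])
    fix a :: real assume a: "0 < a"
    have "(\<integral>\<^sup>+u\<in>{y - a..y + a}. ?G u \<partial>lebesgue)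
        = (\<integral>\<^sup>+u. ennreal \<mu> * indicator {y - a..y + a} u
            + ?c * (?P u * indicator {y - a..y + a} u) \<partial>lebesgue)"
      by (intro nn_integral_cong) (simp add: distrib_right mult.assoc)
    also have "\<dots> = ennreal \<mu> * ennreal (2 * a) + ?c * (\<integral>\<^sup>+u\<in>{y - a..y + a}. ?P u \<partial>lebesgue)"
    proof (subst nn_integral_linear_combination)
      show "(\<lambda>u. ?P u * indicator {y - a..y + a} u) \<in> borel_measurable lebesgue"
        by (intro borel_measurable_times_ennreal borel_measurable_indicator Pm) simp
    qed (use a in \<open>simp_all add: borel_measurable_indicator\<close>)
    also have "\<dots> \<le> ennreal \<mu> * ennreal (2 * a) + ?c * ennreal (12 * a * \<mu> powr p)"
      by (intro add_left_mono mult_left_mono winP[OF a]) simp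
    also have "\<dots> = ennreal (\<mu> * (2 * a) + \<mu> powr (1 - p) * (12 * a * \<mu> powr p))"
      using a mu by (simp add: ennreal_mult ennreal_plus)
    also have "\<mu> powr (1 - p) * (12 * a * \<mu> powr p) = 12 * a * (\<mu> powr (1 - p) * \<mu> powr p)"
      by simp
    also have "\<mu> powr (1 - p) * \<mu> powr p = \<mu>"
      using mu by (simp add: powr_add[symmetric])
    also have "ennreal (\<mu> * (2 * a) + 12 * a * \<mu>) = ennreal (7 * \<mu>) * ennreal (2 * a)"
      using mu a by (subst ennreal_mult[symmetric]) (auto intro!: arg_cong[where f = ennreal] simp: algebra_simps)
    finally show "(\<integral>\<^sup>+u\<in>{y - a..y + a}. ?G u \<partial>lebesgue) \<le> ennreal (7 * \<mu>) * ennreal (2 * a)" .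
  next
    show "?G \<in> borel_measurable lebesgue" by measurable
  qed (auto intro: radial_majorant_mono radial_majorant_eq_0)
  also have "\<dots> \<le> ennreal (7 * \<mu>) * ennreal C"
    unfolding nn_integral_radial_majorant by (intro mult_left_mono C) simp
  also have "\<dots> = ennreal (7 * \<mu> * C)"
    using mu C by (simp add: ennreal_mult)
  finally show ?thesis .
qed


section \<open>The part of the kernel near its centre\<close>

lemma nn_integral_powr_tail:
  fixes b e :: real
  assumes "0 < b" "0 < e"
  shows "(\<integral>\<^sup>+t\<in>{b..}. ennreal (t powr (- 1 - e)) \<partial>lborel) = ennreal (b powr (- e) / e)"
proof -
  have "(\<integral>\<^sup>+t\<in>{b..}. ennreal (t powr (- 1 - e)) \<partial>lborel) = ennreal (0 - (- (b powr (- e) / e)))"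
  proof (rule nn_integral_FTC_atLeast)
    fix t assume "b \<le> t"
    then have "0 < t" using assms by auto
    then show "((\<lambda>t. - (t powr (- e) / e)) has_real_derivative t powr (- 1 - e)) (at t)"
      using assms by (auto intro!: derivative_eq_intros simp: powr_diff powr_minus_divide[of _ e])
  next
    show "((\<lambda>t. - (t powr (- e) / e)) \<longlongrightarrow> 0) at_top"
      using assms by real_asymp
  qed auto
  then show ?thesis by simp
qed

text \<open>
  The two bounds \<open>A\<close> and \<open>B / |t|\<close> cross at \<open>|t| = B / A\<close>; both the plateau and the
  tails contribute a multiple of \<open>A\<^sup>e B\<close>.
\<close>

lemma nn_integral_truncated_kernel_powr:
  fixes A B e :: real
  assumes A: "0 < A" and B: "0 < B" and e: "0 < e"
  shows "(\<integral>\<^sup>+t. ennreal (min A (B / \<bar>t\<bar>) powr (1 + e)) \<partial>lborel)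
    \<le> ennreal (2 * (1 + 1 / e) * A powr e * B)"
proof -
  define b where "b = B / A"
  have b: "0 < b" using A B by (simp add: b_def)
  let ?T = "\<lambda>t. ennreal (B powr (1 + e)) * (ennreal (t powr (- 1 - e)) * indicator {b..} t)"
  have tail: "(\<integral>\<^sup>+t. ?T t \<partial>lborel) = ennreal (A powr e * B / e)"
  proof -
    have "(\<integral>\<^sup>+t. ?T t \<partial>lborel) = ennreal (B powr (1 + e) * (b powr (- e) / e))"
      using e b by (subst nn_integral_cmult) (simp_all add: nn_integral_powr_tail ennreal_mult[symmetric])
    also have "B powr (1 + e) * (b powr (- e) / e) = A powr e * B / e"
      using A B by (simp add: b_def powr_add powr_minus powr_divide field_simps)
    finally show ?thesis .
  qed
  have refl: "(\<integral>\<^sup>+t. ?T (- t) \<partial>lborel) = (\<integral>\<^sup>+t. ?T t \<partial>lborel)"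
    using nn_integral_real_affine[of ?T "-1" 0] by simp
  have "(\<integral>\<^sup>+t. ennreal (min A (B / \<bar>t\<bar>) powr (1 + e)) \<partial>lborel)
      \<le> (\<integral>\<^sup>+t. ennreal (A powr (1 + e)) * indicator {-b..b} t + (?T t + ?T (- t)) \<partial>lborel)"
  proof (rule nn_integral_mono)
    fix t :: real
    consider "\<bar>t\<bar> \<le> b" | "b < t" | "b < - t" by linarith
    then show "ennreal (min A (B / \<bar>t\<bar>) powr (1 + e))
        \<le> ennreal (A powr (1 + e)) * indicator {-b..b} t + (?T t + ?T (- t))"
    proof cases
      case 1
      have "ennreal (min A (B / \<bar>t\<bar>) powr (1 + e)) \<le> ennreal (A powr (1 + e))"
        using A B e by (intro ennreal_leI powr_mono2) auto
      also have "\<dots> = ennreal (A powr (1 + e)) * indicator {-b..b} t"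
        using 1 by (simp add: indicator_def abs_le_iff)
      finally show ?thesis by (rule add_increasing2[OF zero_le])
    next
      case 2
      then have t: "0 < t" using b by auto
      have "ennreal (min A (B / \<bar>t\<bar>) powr (1 + e)) \<le> ennreal ((B / t) powr (1 + e))"
        using A B e t by (intro ennreal_leI powr_mono2) auto
      also have "(B / t) powr (1 + e) = B powr (1 + e) * t powr (- 1 - e)"
        using powr_minus_divide[of t "1 + e"] powr_divide[of B t "1 + e"] t B by simp
      finally show ?thesis using 2 by (simp add: ennreal_mult add_increasing add_increasing2)
    next
      case 3
      then have t: "0 < - t" using b by auto
      have "ennreal (min A (B / \<bar>t\<bar>) powr (1 + e)) \<le> ennreal ((B / (- t)) powr (1 + e))"
        using A B e t by (intro ennreal_leI powr_mono2) (auto simp: divide_le_0_iff)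
      also have "(B / (- t)) powr (1 + e) = B powr (1 + e) * (- t) powr (- 1 - e)"
        using powr_minus_divide[of "- t" "1 + e"] powr_divide[of B "- t" "1 + e"] t B by simp
      finally show ?thesis using 3 by (simp add: ennreal_mult add_increasing add_increasing2)
    qed
  qed
  also have "\<dots> = ennreal (A powr (1 + e)) * ennreal (2 * b)
      + (ennreal (A powr e * B / e) + ennreal (A powr e * B / e))"
    using b by (simp add: nn_integral_add nn_integral_cmult tail refl)
  also have "\<dots> = ennreal (A powr (1 + e) * (2 * b) + (A powr e * B / e + A powr e * B / e))"
  proof -
    have "ennreal u * ennreal v + (ennreal w + ennreal w) = ennreal (u * v + (w + w))"
      if "0 \<le> u" "0 \<le> v" "0 \<le> w" for u v w
      using that by (simp only: ennreal_mult ennreal_plus mult_nonneg_nonneg add_nonneg_nonneg)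
    then show ?thesis using A B e b by simp
  qed
  also have "A powr (1 + e) * (2 * b) + (A powr e * B / e + A powr e * B / e)
      = 2 * (1 + 1 / e) * A powr e * B"
    using A by (simp add: b_def powr_add field_simps)
  finally show ?thesis .
qed

text \<open>
  With \<open>e = 1/(p - 1)\<close>, so that \<open>1 + e\<close> is the exponent conjugate to \<open>p\<close>, and
  \<open>\<kappa>(t) = min A (B / |t|)\<close>, the weight \<open>w = \<mu> (\<kappa> D)\<^sup>e\<close> makes the coefficient
  \<open>\<kappa> w\<^sup>1\<^sup>-\<^sup>p = \<mu>\<^sup>1\<^sup>-\<^sup>p / D\<close> of \<open>|f|\<^sup>p\<close> constant, and leaves \<open>\<kappa> w = \<mu> D\<^sup>e \<kappa>\<^sup>1\<^sup>+\<^sup>e\<close>, whose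
  integral is controlled by \<open>D\<^sup>e A\<^sup>e B = (D A B\<^sup>p\<^sup>-\<^sup>1)\<^sup>e\<close>.
\<close>

lemma nn_integral_kernel_core_le:
  fixes f :: "real \<Rightarrow> complex" and q :: "real \<Rightarrow> real"
  assumes f[measurable]: "f \<in> borel_measurable lebesgue"
    and p: "1 < p" and mu: "0 < \<mu>" and D: "0 < D" and A: "0 < A" and B: "0 < B"
    and win: "(\<integral>\<^sup>+u\<in>{y - D..y + D}. ennreal (norm (f u) powr p) \<partial>lebesgue) \<le> ennreal (12 * D * \<mu> powr p)"
    and q: "AE u in lebesgue. \<bar>u - y\<bar> \<le> D \<longrightarrow> q u \<le> A"
    and qB: "\<And>u. \<bar>u - y\<bar> \<le> D \<Longrightarrow> \<bar>u - y\<bar> * q u \<le> B"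
    and P: "D * A * B powr (p - 1) \<le> P"
  shows "(\<integral>\<^sup>+u\<in>{y - D..y + D}. ennreal (q u * norm (f u)) \<partial>lebesgue)
    \<le> ennreal ((12 + 2 * p * P powr (1 / (p - 1))) * \<mu>)"
proof -
  define e where "e = 1 / (p - 1)"
  have e: "0 < e" "1 + 1 / e = p" "e * (p - 1) = 1" "e * (1 - p) = - 1"
    using p by (auto simp: e_def field_simps)
  define \<kappa> where "\<kappa> t = min A (B / \<bar>t\<bar>)" for t
  let ?W = "\<lambda>u. ennreal (\<mu> * D powr e) * ennreal (\<kappa> (u - y) powr (1 + e))"
  let ?V = "\<lambda>u. ennreal (\<mu> powr (1 - p) / D) * (ennreal (norm (f u) powr p) * indicator {y - D..y + D} u)"
  have "(\<integral>\<^sup>+u\<in>{y - D..y + D}. ennreal (q u * norm (f u)) \<partial>lebesgue)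
      \<le> (\<integral>\<^sup>+u. ?W u + ?V u \<partial>lebesgue)"
  proof (rule nn_integral_mono_AE)
    have "AE u in lebesgue. u \<noteq> y"
      using AE_not_in[of "{y}" lebesgue] by (simp add: negligible_iff_null_sets[symmetric])
    with q show "AE u in lebesgue. ennreal (q u * norm (f u)) * indicator {y - D..y + D} u \<le> ?W u + ?V u"
    proof eventually_elim
      fix u assume qA: "\<bar>u - y\<bar> \<le> D \<longrightarrow> q u \<le> A" and uy: "u \<noteq> y"
      show "ennreal (q u * norm (f u)) * indicator {y - D..y + D} u \<le> ?W u + ?V u"
      proof (cases "\<bar>u - y\<bar> \<le> D")
        case True
        define z where "z = \<kappa> (u - y)"
        have z: "0 < z" using A B uy by (simp add: z_def \<kappa>_def)
        have qz: "q u \<le> z"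
          using qA qB[OF True] True uy by (simp add: z_def \<kappa>_def pos_le_divide_eq mult.commute)
        define w where "w = \<mu> * (z * D) powr e"
        have w: "0 < w" using mu z D by (simp add: w_def)
        have zw: "z * w = \<mu> * D powr e * z powr (1 + e)"
          using z D by (simp add: w_def powr_mult powr_add)
        have wp: "z * w powr (1 - p) = \<mu> powr (1 - p) / D"
        proof -
          have "w powr (1 - p) = \<mu> powr (1 - p) * (z * D) powr (e * (1 - p))"
            by (simp add: w_def powr_mult powr_powr)
          also have "(z * D) powr (e * (1 - p)) = 1 / (z * D)"
            unfolding e(4) using z D by (simp add: powr_minus_divide)
          finally show ?thesis using z D by simp
        qed
        have "q u * norm (f u) \<le> z * (w + w powr (1 - p) * norm (f u) powr p)"
          using qz z w p by (intro mult_mono le_add_powr_scaled) auto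
        also have "\<dots> = \<mu> * D powr e * z powr (1 + e) + \<mu> powr (1 - p) / D * norm (f u) powr p"
          by (simp only: distrib_left mult.assoc[symmetric] zw wp)
        finally have "ennreal (q u * norm (f u))
            \<le> ennreal (\<mu> * D powr e * z powr (1 + e) + \<mu> powr (1 - p) / D * norm (f u) powr p)"
          by (rule ennreal_leI)
        also have "\<dots> = ennreal (\<mu> * D powr e) * ennreal (z powr (1 + e))
            + ennreal (\<mu> powr (1 - p) / D) * ennreal (norm (f u) powr p)"
          using mu D by (simp add: ennreal_mult[symmetric] ennreal_plus[symmetric] del: ennreal_plus)
        finally show ?thesis
          using True by (simp add: z_def indicator_def abs_le_iff)
      qed (auto simp: indicator_def abs_le_iff)
    qed
  qed
  also have "\<dots> = ennreal (\<mu> * D powr e) * (\<integral>\<^sup>+u. ennreal (\<kappa> (u - y) powr (1 + e)) \<partial>lebesgue)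
      + ennreal (\<mu> powr (1 - p) / D)
          * (\<integral>\<^sup>+u\<in>{y - D..y + D}. ennreal (norm (f u) powr p) \<partial>lebesgue)"
  proof (rule nn_integral_linear_combination)
    have "(\<lambda>u. ennreal (\<kappa> (u - y) powr (1 + e))) \<in> borel_measurable lborel"
      unfolding \<kappa>_def by measurable
    then show "(\<lambda>u. ennreal (\<kappa> (u - y) powr (1 + e))) \<in> borel_measurable lebesgue"
      by (rule measurable_completion)
    have "(\<lambda>u. ennreal (norm (f u) powr p)) \<in> borel_measurable lebesgue" by measurable
    then show "(\<lambda>u. ennreal (norm (f u) powr p) * indicator {y - D..y + D} u) \<in> borel_measurable lebesgue"
      by (intro borel_measurable_times_ennreal borel_measurable_indicator) simp_all
  qed
  also have "(\<integral>\<^sup>+u. ennreal (\<kappa> (u - y) powr (1 + e)) \<partial>lebesgue)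
      = (\<integral>\<^sup>+t. ennreal (\<kappa> t powr (1 + e)) \<partial>lborel)"
    using nn_integral_real_affine[of "\<lambda>u. ennreal (\<kappa> (u - y) powr (1 + e))" 1 y]
    by (simp add: nn_integral_completion \<kappa>_def)
  also have "ennreal (\<mu> * D powr e) * \<dots> + ennreal (\<mu> powr (1 - p) / D)
        * (\<integral>\<^sup>+u\<in>{y - D..y + D}. ennreal (norm (f u) powr p) \<partial>lebesgue)
      \<le> ennreal (\<mu> * D powr e) * ennreal (2 * (1 + 1 / e) * A powr e * B)
        + ennreal (\<mu> powr (1 - p) / D) * ennreal (12 * D * \<mu> powr p)"
    unfolding \<kappa>_def using A B e
    by (intro add_mono mult_left_mono win nn_integral_truncated_kernel_powr) auto
  also have "\<dots> = ennreal (\<mu> * D powr e * (2 * (1 + 1 / e) * A powr e * B)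
        + \<mu> powr (1 - p) / D * (12 * D * \<mu> powr p))"
    using mu D A B e(1) by (simp only: ennreal_mult[symmetric] ennreal_plus[symmetric]
      mult_nonneg_nonneg add_nonneg_nonneg powr_ge_zero divide_nonneg_nonneg less_imp_le
      zero_le_numeral zero_le_one)
  also have "\<dots> \<le> ennreal ((12 + 2 * p * P powr (1 / (p - 1))) * \<mu>)"
  proof (rule ennreal_leI)
    have "D powr e * A powr e * B = (D * A * B powr (p - 1)) powr e"
      using D A B e by (simp add: powr_mult powr_powr mult.commute)
    also have "\<dots> \<le> P powr e"
      using P D A B e by (intro powr_mono2) auto
    finally have DAB: "D powr e * A powr e * B \<le> P powr e" .
    have "\<mu> powr (1 - p) / D * (12 * D * \<mu> powr p) = 12 * (\<mu> powr (1 - p) * \<mu> powr p)"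
      using D by simp
    also have "\<dots> = 12 * \<mu>"
      using mu by (simp add: powr_add[symmetric])
    finally have 2: "\<mu> powr (1 - p) / D * (12 * D * \<mu> powr p) = 12 * \<mu>" .
    have "\<mu> * D powr e * (2 * (1 + 1 / e) * A powr e * B) = 2 * p * \<mu> * (D powr e * A powr e * B)"
      by (simp add: e)
    also have "\<dots> \<le> 2 * p * \<mu> * P powr e"
      using DAB p mu by (intro mult_left_mono) auto
    finally show "\<mu> * D powr e * (2 * (1 + 1 / e) * A powr e * B)
        + \<mu> powr (1 - p) / D * (12 * D * \<mu> powr p) \<le> (12 + 2 * p * P powr (1 / (p - 1))) * \<mu>"
      unfolding 2 by (simp add: e_def algebra_simps)
  qed
  finally show ?thesis .
qed

text \<open>
  For \<open>p > 1\<close> the finiteness of \<open>\<phi>\<^sub>*\<close> is a consequence of the hypothesis on the product as soon as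
  the kernel does not vanish almost everywhere. The term \<open>12 P\<close> of the constant serves \<open>p = 1\<close>, where
  only the supremum of the kernel enters.
\<close>

lemma nn_integral_circle_kernel_core_le:
  fixes f :: "real \<Rightarrow> complex"
  assumes k: "circle_fun k" and f[measurable]: "f \<in> borel_measurable lebesgue"
    and p: "1 \<le> p" and mu: "0 < \<mu>" and D: "0 < D" "D \<le> pi"
    and win: "(\<integral>\<^sup>+u\<in>{y - D..y + D}. ennreal (norm (f u) powr p) \<partial>lebesgue) \<le> ennreal (12 * D * \<mu> powr p)"
    and fin: "Linf_norm k < top"
    and P: "ennreal D * Linf_norm k * epow (phi_star k) (p - 1) \<le> ennreal P" "0 \<le> P"
  shows "(\<integral>\<^sup>+u\<in>{y - D..y + D}. ennreal (norm (k (y - u)) * norm (f u)) \<partial>lebesgue)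
    \<le> ennreal ((12 + 12 * P + 2 * p * P powr (1 / (p - 1))) * \<mu>)"
proof -
  obtain A where A: "Linf_norm k = ennreal A" "0 \<le> A"
    using fin by (cases "Linf_norm k") auto
  have kA: "AE u in lebesgue. \<bar>u - y\<bar> \<le> D \<longrightarrow> norm (k (y - u)) \<le> A"
    using AE_norm_le_Linf_norm[OF A, of y] D(2) by (auto elim!: eventually_mono)
  have zero: ?thesis if "AE u in lebesgue. \<bar>u - y\<bar> \<le> D \<longrightarrow> norm (k (y - u)) = 0"
  proof -
    have "(\<integral>\<^sup>+u\<in>{y - D..y + D}. ennreal (norm (k (y - u)) * norm (f u)) \<partial>lebesgue)
        = (\<integral>\<^sup>+(u::real). 0 \<partial>lebesgue)"
      using that by (intro nn_integral_cong_AE) (auto elim!: eventually_mono simp: indicator_def abs_le_iff)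
    then show ?thesis by simp
  qed
  show ?thesis
  proof (cases "A = 0")
    case True
    show ?thesis by (rule zero) (use kA True in \<open>auto elim!: eventually_mono\<close>)
  next
    case False
    then have A0: "0 < A" using A by simp
    show ?thesis
    proof (cases "p = 1")
      case True
      have DA: "D * A \<le> P"
        using P A D A0 True by (simp add: epow_def ennreal_mult[symmetric])
      have "(\<integral>\<^sup>+u\<in>{y - D..y + D}. ennreal (norm (k (y - u)) * norm (f u)) \<partial>lebesgue)
          \<le> (\<integral>\<^sup>+u. ennreal A * (ennreal (norm (f u) powr p) * indicator {y - D..y + D} u) \<partial>lebesgue)"
      proof (rule nn_integral_mono_AE)
        show "AE u in lebesgue. ennreal (norm (k (y - u)) * norm (f u)) * indicator {y - D..y + D} u
            \<le> ennreal A * (ennreal (norm (f u) powr p) * indicator {y - D..y + D} u)"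
          using kA
        proof eventually_elim
          case (elim u)
          then show ?case
            using True A by (auto simp: indicator_def abs_le_iff ennreal_mult[symmetric] intro!: ennreal_leI mult_right_mono)
        qed
      qed
      also have "\<dots> = ennreal A * (\<integral>\<^sup>+u\<in>{y - D..y + D}. ennreal (norm (f u) powr p) \<partial>lebesgue)"
      proof (rule nn_integral_cmult)
        have "(\<lambda>u. ennreal (norm (f u) powr p)) \<in> borel_measurable lebesgue" by measurable
        then show "(\<lambda>u. ennreal (norm (f u) powr p) * indicator {y - D..y + D} u) \<in> borel_measurable lebesgue"
          by (intro borel_measurable_times_ennreal borel_measurable_indicator) simp_all
      qed
      also have "\<dots> \<le> ennreal A * ennreal (12 * D * \<mu> powr p)"
        by (intro mult_left_mono win) simp
      also have "\<dots> = ennreal (12 * (D * A) * \<mu>)"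
        using A mu True by (simp add: ennreal_mult'[symmetric] mult_ac)
      also have "\<dots> \<le> ennreal ((12 + 12 * P + 2 * p * P powr (1 / (p - 1))) * \<mu>)"
      proof (intro ennreal_leI mult_right_mono)
        have "0 \<le> 2 * p * P powr (1 / (p - 1))" using p by simp
        with DA show "12 * (D * A) \<le> 12 + 12 * P + 2 * p * P powr (1 / (p - 1))" by linarith
      qed (use mu in simp)
      finally show ?thesis .
    next
      case False
      with p have p1: "1 < p" by simp
      have "phi_star k \<noteq> top"
      proof
        assume "phi_star k = top"
        then have "ennreal D * Linf_norm k * epow (phi_star k) (p - 1) = top"
          using A A0 D p1 by (simp add: epow_def ennreal_mult_eq_top_iff ennreal_mult_top)
        with P show False by (simp add: top_unique)
      qed
      then obtain B where B: "phi_star k = ennreal B" "0 \<le> B"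
        by (cases "phi_star k") auto
      have kB: "\<bar>u - y\<bar> * norm (k (y - u)) \<le> B" if "\<bar>u - y\<bar> \<le> D" for u
        using norm_le_phi_star[of k B "y - u"] B that D(2) by (simp add: abs_minus_commute)
      show ?thesis
      proof (cases "B = 0")
        case True
        have "AE u in lebesgue. u \<noteq> y"
          using AE_not_in[of "{y}" lebesgue] by (simp add: negligible_iff_null_sets[symmetric])
        then have "AE u in lebesgue. \<bar>u - y\<bar> \<le> D \<longrightarrow> norm (k (y - u)) = 0"
        proof eventually_elim
          case (elim u)
          then show ?case using kB[of u] True by (auto simp: mult_le_0_iff)
        qed
        then show ?thesis by (rule zero)
      next
        case False
        with B have B0: "0 < B" by simp
        have "ennreal (D * A * B powr (p - 1)) \<le> ennreal P"
          using P A B D p1 by (simp add: epow_def ennreal_mult)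
        then have DAB: "D * A * B powr (p - 1) \<le> P" using P(2) by simp
        have "(\<integral>\<^sup>+u\<in>{y - D..y + D}. ennreal (norm (k (y - u)) * norm (f u)) \<partial>lebesgue)
            \<le> ennreal ((12 + 2 * p * P powr (1 / (p - 1))) * \<mu>)"
          by (rule nn_integral_kernel_core_le[OF f p1 mu D(1) A0 B0 win kA kB DAB])
        also have "\<dots> \<le> ennreal ((12 + 12 * P + 2 * p * P powr (1 / (p - 1))) * \<mu>)"
          using P(2) mu by (intro ennreal_leI mult_right_mono) auto
        finally show ?thesis .
      qed
    qed
  qed
qed


section \<open>Convolutions on the circle\<close>

text \<open>
  Over \<open>[y - \<pi>, y + \<pi>]\<close> the argument of the kernel runs through \<open>[-\<pi>, \<pi>]\<close>, where its majorant is
  meaningful. The factor \<open>3\<close> comes from covering \<open>[-\<pi>, \<pi>]\<close> by three periods around \<open>y\<close>.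
\<close>

lemma circle_conv_le_window:
  assumes k: "circle_fun k" and f: "circle_fun f" and y: "\<bar>y\<bar> \<le> 2 * pi"
  shows "ennreal (norm (circle_conv k f y))
    \<le> 3 * (\<integral>\<^sup>+u\<in>{y - pi..y + pi}. ennreal (norm (k (y - u)) * norm (f u)) \<partial>lebesgue)"
proof -
  let ?h = "\<lambda>u. ennreal (norm (k (y - u)) * norm (f u))"
  have km: "k \<in> borel_measurable lebesgue" and fm[measurable]: "f \<in> borel_measurable lebesgue"
    using k f by (auto simp: circle_fun_def)
  note [measurable] = borel_measurable_lebesgue_reflect[OF km, of y]
  have per: "?h (u + 2 * pi) = ?h u" for u
  proof -
    have "k (y - (u + 2 * pi) + 2 * pi) = k (y - (u + 2 * pi))"
      using k unfolding circle_fun_def by blast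
    then show ?thesis using f by (simp add: circle_fun_def)
  qed
  have "ennreal (norm (circle_conv k f y)) \<le> (\<integral>\<^sup>+u. ?h u \<partial>circle_measure)"
  proof (cases "integrable circle_measure (\<lambda>u. k (y - u) * f u)")
    case True
    from integral_norm_bound_ennreal[OF this] show ?thesis
      by (simp add: circle_conv_def norm_mult)
  next
    case False
    then show ?thesis by (simp add: circle_conv_def not_integrable_integral_eq)
  qed
  also have "\<dots> \<le> (\<integral>\<^sup>+u\<in>{y - 3 * pi..y + 3 * pi}. ?h u \<partial>lebesgue)"
    unfolding nn_integral_circle using y by (intro nn_integral_mono) (auto simp: indicator_def)
  also have "\<dots> \<le> 3 * (\<integral>\<^sup>+u\<in>{y - pi..y + pi}. ?h u \<partial>lebesgue)"
    by (rule periodic_window_le) (auto simp only: per, measurable)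
  finally show ?thesis .
qed

text \<open>
  The estimate is stated for an arbitrary level \<open>\<mu> > 0\<close> with \<open>M|f|\<^sup>p(x) \<le> \<mu>\<^sup>p\<close>: the weights in the
  two parts need \<open>\<mu> > 0\<close>, which \<open>\<mu>\<^sup>p = M|f|\<^sup>p(x)\<close> would not guarantee.
\<close>

lemma norm_circle_conv_le_HL_max:
  assumes k: "circle_fun k" and f: "circle_fun f"
    and p: "1 \<le> p" and mu: "0 < \<mu>" and D: "0 < D" "D \<le> pi"
    and xy: "\<bar>x - y\<bar> \<le> D" and y: "\<bar>y\<bar> \<le> 2 * pi"
    and HL: "HL_max (\<lambda>t. norm (f t) powr p) x \<le> ennreal (\<mu> powr p)"
    and C: "(\<integral>\<^sup>+t. radial_majorant k t \<partial>circle_measure) \<le> ennreal C" "0 \<le> C"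
    and fin: "Linf_norm k < top"
    and P: "ennreal D * Linf_norm k * epow (phi_star k) (p - 1) \<le> ennreal P" "0 \<le> P"
  shows "norm (circle_conv k f y)
    \<le> 3 * (12 + 12 * P + 2 * p * P powr (1 / (p - 1)) + 7 * C) * \<mu>"
proof -
  have fm[measurable]: "f \<in> borel_measurable lebesgue" and km: "k \<in> borel_measurable lebesgue"
    using k f by (auto simp: circle_fun_def)
  note [measurable] = borel_measurable_lebesgue_reflect[OF km, of y]
  let ?h = "\<lambda>u. ennreal (norm (k (y - u)) * norm (f u))"
  let ?S = "{u. D < \<bar>u - y\<bar> \<and> \<bar>u - y\<bar> \<le> pi}"
  let ?N = "12 + 12 * P + 2 * p * P powr (1 / (p - 1))"
  have win: "(\<integral>\<^sup>+u\<in>{x - s..x + s}. ennreal (norm (f u) powr p) \<partial>lebesgue) \<le> ennreal (6 * s * \<mu> powr p)"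
    if s: "0 < s" "s \<le> 2 * pi" for s
  proof -
    have "(\<integral>\<^sup>+u\<in>{x - s..x + s}. ennreal \<bar>norm (f u) powr p\<bar> \<partial>lebesgue)
        \<le> ennreal (6 * s) * HL_max (\<lambda>t. norm (f t) powr p) x"
      using s f by (intro periodic_window_le_HL_max) (auto simp: circle_fun_def)
    also have "\<dots> \<le> ennreal (6 * s) * ennreal (\<mu> powr p)"
      by (intro mult_left_mono HL) simp
    finally show ?thesis using s by (simp add: ennreal_mult)
  qed
  have near: "(\<integral>\<^sup>+u\<in>{y - D..y + D}. ?h u \<partial>lebesgue) \<le> ennreal (?N * \<mu>)"
  proof (rule nn_integral_circle_kernel_core_le[OF k fm p mu D _ fin P])
    have "(\<integral>\<^sup>+u\<in>{y - D..y + D}. ennreal (norm (f u) powr p) \<partial>lebesgue)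
        \<le> (\<integral>\<^sup>+u\<in>{x - 2 * D..x + 2 * D}. ennreal (norm (f u) powr p) \<partial>lebesgue)"
      using xy by (intro nn_integral_mono) (auto simp: indicator_def)
    also have "\<dots> \<le> ennreal (6 * (2 * D) * \<mu> powr p)"
      using D by (intro win) auto
    finally show "(\<integral>\<^sup>+u\<in>{y - D..y + D}. ennreal (norm (f u) powr p) \<partial>lebesgue)
        \<le> ennreal (12 * D * \<mu> powr p)" by simp
  qed
  have "(\<integral>\<^sup>+u\<in>?S. ?h u \<partial>lebesgue)
      \<le> (\<integral>\<^sup>+u\<in>?S. radial_majorant k (u - y) * ennreal (norm (f u)) \<partial>lebesgue)"
  proof (rule nn_integral_mono)
    fix u
    show "?h u * indicator ?S u \<le> radial_majorant k (u - y) * ennreal (norm (f u)) * indicator ?S u"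
    proof (cases "u \<in> ?S")
      case True
      have "ennreal (norm (k (y - u))) \<le> radial_majorant k (y - u)"
        using True by (intro norm_le_radial_majorant) auto
      also have "\<dots> \<le> radial_majorant k (u - y)"
        by (rule radial_majorant_mono) simp
      finally show ?thesis
        using True by (simp add: ennreal_mult mult_right_mono)
    qed simp
  qed
  also have "\<dots> \<le> ennreal (7 * \<mu> * C)"
    using fm p mu xy win C by (rule nn_integral_kernel_tail_le)
  finally have far: "(\<integral>\<^sup>+u\<in>?S. ?h u \<partial>lebesgue) \<le> ennreal (7 * \<mu> * C)" .
  have "(\<integral>\<^sup>+u\<in>{y - pi..y + pi}. ?h u \<partial>lebesgue)
      = (\<integral>\<^sup>+u. 1 * (?h u * indicator {y - D..y + D} u) + 1 * (?h u * indicator ?S u) \<partial>lebesgue)"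
    using D by (intro nn_integral_cong) (auto simp: indicator_def)
  also have "\<dots> = 1 * (\<integral>\<^sup>+u\<in>{y - D..y + D}. ?h u \<partial>lebesgue) + 1 * (\<integral>\<^sup>+u\<in>?S. ?h u \<partial>lebesgue)"
  proof (rule nn_integral_linear_combination)
    have h: "?h \<in> borel_measurable lebesgue" by measurable
    have "?S \<in> sets borel" by measurable
    then show "(\<lambda>u. ?h u * indicator ?S u) \<in> borel_measurable lebesgue"
      by (intro borel_measurable_times_ennreal borel_measurable_indicator h) simp
    show "(\<lambda>u. ?h u * indicator {y - D..y + D} u) \<in> borel_measurable lebesgue"
      by (intro borel_measurable_times_ennreal borel_measurable_indicator h) simp
  qed
  also have "\<dots> \<le> 1 * ennreal (?N * \<mu>) + 1 * ennreal (7 * \<mu> * C)"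
    by (intro add_mono mult_left_mono near far) simp_all
  finally have all: "(\<integral>\<^sup>+u\<in>{y - pi..y + pi}. ?h u \<partial>lebesgue) \<le> ennreal (?N * \<mu>) + ennreal (7 * \<mu> * C)"
    by simp
  have N: "0 \<le> ?N" using P p by simp
  have "ennreal (norm (circle_conv k f y)) \<le> 3 * (\<integral>\<^sup>+u\<in>{y - pi..y + pi}. ?h u \<partial>lebesgue)"
    by (rule circle_conv_le_window[OF k f y])
  also have "\<dots> \<le> 3 * (ennreal (?N * \<mu>) + ennreal (7 * \<mu> * C))"
    by (intro mult_left_mono all) simp
  also have "\<dots> = ennreal (3 * (?N * \<mu> + 7 * \<mu> * C))"
  proof -
    have "3 * (ennreal a + ennreal b) = ennreal (3 * (a + b))" if "0 \<le> a" "0 \<le> b" for a b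
      using that ennreal_mult'[of 3 "a + b"] by (simp add: ennreal_plus)
    then show ?thesis using N mu C(2) by simp
  qed
  finally have "norm (circle_conv k f y) \<le> 3 * (?N * \<mu> + 7 * \<mu> * C)"
    using N mu C(2) by (subst (asm) ennreal_le_iff) auto
  also have "\<dots> = 3 * (?N + 7 * C) * \<mu>" by (simp add: algebra_simps)
  finally show ?thesis by (simp only: add.assoc)
qed

lemma circle_conv_periodic:
  assumes "circle_fun k" "y' = y \<or> y' = y + 2 * pi \<or> y' = y - 2 * pi"
  shows "circle_conv k f y' = circle_conv k f y"
proof -
  have per: "k (z + 2 * pi) = k z" for z
    using assms(1) by (simp add: circle_fun_def)
  have "k (y' - t) = k (y - t)" for t
    using assms(2) per[of "y - t"] per[of "y - 2 * pi - t"] by (auto simp: algebra_simps)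
  then show ?thesis by (simp add: circle_conv_def)
qed


section \<open>Distances on the circle and level sets\<close>

lemma circle_dist_less_iff: "circle_dist x y < L \<longleftrightarrow> (\<exists>k::int. \<bar>x - y + 2 * pi * of_int k\<bar> < L)"
  unfolding circle_dist_def
  by (subst cINF_less_iff) (auto intro!: bdd_belowI[of _ 0])

text \<open>
  The representative at distance at most \<open>\<pi>\<close> from \<open>x\<close> is at least as close as any other, so it inherits
  the bound by \<open>L\<close>, however large \<open>L\<close> is.
\<close>

lemma circle_dist_representative:
  assumes x: "x \<in> circle" and y: "y \<in> circle" and L: "circle_dist x y < L"
  obtains y' where "y' = y \<or> y' = y + 2 * pi \<or> y' = y - 2 * pi"
    "\<bar>x - y'\<bar> < L" "\<bar>x - y'\<bar> \<le> pi" "\<bar>y'\<bar> \<le> 2 * pi"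
proof -
  obtain k :: int where k: "\<bar>x - y + 2 * pi * of_int k\<bar> < L"
    using L by (auto simp: circle_dist_less_iff)
  have "\<exists>m::int. (m = 0 \<or> m = 1 \<or> m = -1) \<and> \<bar>x - y + 2 * pi * of_int m\<bar> \<le> pi"
  proof -
    consider "\<bar>x - y\<bar> \<le> pi" | "pi < x - y" | "x - y < - pi" by linarith
    then show ?thesis
    proof cases
      case 1 then show ?thesis by (intro exI[of _ 0]) simp
    next
      case 2 then show ?thesis using x y by (intro exI[of _ "-1"]) auto
    next
      case 3 then show ?thesis using x y by (intro exI[of _ 1]) auto
    qed
  qed
  then obtain m :: int where m: "m = 0 \<or> m = 1 \<or> m = -1" "\<bar>x - y + 2 * pi * of_int m\<bar> \<le> pi"
    by blast
  have "\<bar>x - y + 2 * pi * of_int m\<bar> < L"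
  proof (cases "k = m")
    case False
    then have "1 \<le> \<bar>k - m\<bar>" by linarith
    then have "1 \<le> \<bar>of_int k - of_int m :: real\<bar>" by linarith
    then have "2 * pi * 1 \<le> 2 * pi * \<bar>of_int k - of_int m\<bar>"
      by (intro mult_left_mono) auto
    also have "\<dots> = \<bar>2 * pi * of_int k - 2 * pi * of_int m\<bar>"
      by (simp add: abs_mult right_diff_distrib[symmetric])
    finally have "2 * pi \<le> \<bar>2 * pi * of_int k - 2 * pi * of_int m\<bar>" by simp
    then show ?thesis using m(2) k by linarith
  qed (use k in simp)
  moreover have "\<bar>y - 2 * pi * of_int m\<bar> \<le> 2 * pi"
    using x m(2) by auto
  ultimately show ?thesis
    using m by (intro that[of "y - 2 * pi * of_int m"]) (auto simp: algebra_simps)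
qed

text \<open>
  A pair \<open>(y, r)\<close> that witnesses a large value at \<open>x\<close> does so at all points near \<open>x\<close>, because
  \<open>|x - y| < \<lambda>(r)\<close> is an open condition on \<open>x\<close>. This is the source of measurability of the level sets.
\<close>

lemma open_Phi_max_superlevel:
  "\<exists>U. open U \<and> {x \<in> circle. t < Phi_max \<phi> lam f x} = circle \<inter> U"
proof -
  define Q where "Q = {(y, r). y \<in> circle \<and> 0 < r \<and> r < 1 \<and> t < ennreal (norm (circle_conv (\<phi> r) f y))}"
  define U where "U = (\<Union>(y, r)\<in>Q. \<Union>k::int. {x. \<bar>x - y + 2 * pi * of_int k\<bar> < lam r})"
  have "open U"
    unfolding U_def by (intro open_UN ballI) (auto intro!: open_UN open_Collect_less continuous_intros)
  moreover have "{x \<in> circle. t < Phi_max \<phi> lam f x} = circle \<inter> U"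
    unfolding Phi_max_def U_def Q_def less_SUP_iff circle_dist_less_iff by auto
  ultimately show ?thesis by blast
qed

lemma less_epow_inverseD:
  assumes "ennreal m < epow u (1 / p)" "0 \<le> m" "1 \<le> p"
  shows "ennreal (m powr p) < u"
proof (cases u)
  case (real v)
  then have "m < v powr (1 / p)"
    using assms by (simp add: epow_def ennreal_less_iff)
  then have "m powr p < (v powr (1 / p)) powr p"
    using assms by (intro powr_less_mono2) auto
  then show ?thesis using real assms by (simp add: powr_powr ennreal_less_iff)
qed simp

lemma Lp_norm_powr:
  assumes "Lp_norm p f < top" "1 \<le> p"
  shows "epow (Lp_norm p f) p = (\<integral>\<^sup>+t. ennreal (norm (f t) powr p) \<partial>circle_measure)"
proof (cases "\<integral>\<^sup>+t. ennreal (norm (f t) powr p) \<partial>circle_measure")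
  case (real v)
  then show ?thesis using assms(2) by (simp add: Lp_norm_def epow_def powr_powr)
next
  case top
  then show ?thesis using assms by (simp add: Lp_norm_def epow_def)
qed


section \<open>The pointwise and the weak type estimate for the maximal operator\<close>

theorem theorem2p2:
  fixes \<phi> :: "real \<Rightarrow> real \<Rightarrow> complex" and lam :: "real \<Rightarrow> real" and p :: real
  assumes "approximate_identity \<phi>"
    and "1 \<le> p"
    and "\<And>r. 0 < r \<Longrightarrow> r < 1 \<Longrightarrow> 0 < lam r"
    and "Pi_tilde p lam \<phi> < top"
  shows "(\<exists>C::real. 0 < C \<and> (\<forall>f\<in>Lp p. \<forall>x\<in>circle.
            Phi_max \<phi> lam f x \<le> ennreal C * epow (HL_max (\<lambda>t. norm (f t) powr p) x) (1 / p)))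
       \<and> (\<exists>C::real. 0 < C \<and> (\<forall>f\<in>Lp p. \<forall>t>0.
            {x \<in> circle. Phi_max \<phi> lam f x > ennreal t} \<in> sets circle_measure \<and>
            emeasure circle_measure {x \<in> circle. Phi_max \<phi> lam f x > ennreal t}
              \<le> ennreal (C / t powr p) * epow (Lp_norm p f) p))"
proof -
  note p = \<open>1 \<le> p\<close>
  have "(SUP r\<in>{0<..<1}. \<integral>\<^sup>+ x. radial_majorant (\<phi> r) x \<partial>circle_measure) < top"
    using assms(1) by (simp add: approximate_identity_def)
  then obtain C where supC: "(SUP r\<in>{0<..<1}. \<integral>\<^sup>+ x. radial_majorant (\<phi> r) x \<partial>circle_measure) = ennreal C"
    and C: "0 \<le> C"
    by (cases "SUP r\<in>{0<..<1}. \<integral>\<^sup>+ x. radial_majorant (\<phi> r) x \<partial>circle_measure") auto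
  obtain P where supP: "Pi_tilde p lam \<phi> = ennreal P" and P: "0 \<le> P"
    using assms(4) by (cases "Pi_tilde p lam \<phi>") auto
  define K where "K = 3 * (12 + 12 * P + 2 * p * P powr (1 / (p - 1)) + 7 * C)"
  have "0 \<le> 2 * p * P powr (1 / (p - 1))" using p by simp
  then have K: "0 < K" using C P by (simp add: K_def)
  have conv: "norm (circle_conv (\<phi> r) f y) \<le> K * \<mu>"
    if f: "f \<in> Lp p" and x: "x \<in> circle" and y: "y \<in> circle" and r: "0 < r" "r < 1"
      and xy: "circle_dist x y < lam r" and mu: "0 < \<mu>"
      and HL: "HL_max (\<lambda>t. norm (f t) powr p) x \<le> ennreal (\<mu> powr p)" for f x y r \<mu>
  proof -
    have \<phi>: "circle_fun (\<phi> r)" "Linf_norm (\<phi> r) < top"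
      using assms(1) r by (auto simp: approximate_identity_def Linf_def)
    obtain y' where y': "y' = y \<or> y' = y + 2 * pi \<or> y' = y - 2 * pi"
      "\<bar>x - y'\<bar> < lam r" "\<bar>x - y'\<bar> \<le> pi" "\<bar>y'\<bar> \<le> 2 * pi"
      by (rule circle_dist_representative[OF x y xy])
    have "norm (circle_conv (\<phi> r) f y') \<le> K * \<mu>"
      unfolding K_def
    \<comment> \<open>The radius \<open>min \<lambda>(r) \<pi>\<close> is positive even if \<open>y' = x\<close>, at least \<open>\<bar>x - y'\<bar>\<close>, and at most \<open>\<lambda>(r)\<close>.\<close>
    proof (rule norm_circle_conv_le_HL_max[where D = "min (lam r) pi", OF \<phi>(1) _ p mu _ _ _ y'(4) HL _ C \<phi>(2) _ P])
      show "circle_fun f" using f by (simp add: Lp_def)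
      show "0 < min (lam r) pi" using assms(3)[OF r] by simp
      show "\<bar>x - y'\<bar> \<le> min (lam r) pi" using y' by simp
      show "(\<integral>\<^sup>+ t. radial_majorant (\<phi> r) t \<partial>circle_measure) \<le> ennreal C"
        unfolding supC[symmetric] using r by (intro SUP_upper) auto
      have "ennreal (min (lam r) pi) * Linf_norm (\<phi> r) * epow (phi_star (\<phi> r)) (p - 1)
          \<le> ennreal (lam r) * Linf_norm (\<phi> r) * epow (phi_star (\<phi> r)) (p - 1)"
        by (intro mult_right_mono ennreal_leI) auto
      also have "\<dots> \<le> ennreal P"
        unfolding supP[symmetric] Pi_tilde_def using r by (intro SUP_upper) auto
      finally show "ennreal (min (lam r) pi) * Linf_norm (\<phi> r) * epow (phi_star (\<phi> r)) (p - 1)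
          \<le> ennreal P" .
    qed simp
    then show ?thesis using circle_conv_periodic[OF \<phi>(1) y'(1)] by simp
  qed
  have main: "Phi_max \<phi> lam f x \<le> ennreal K * epow (HL_max (\<lambda>t. norm (f t) powr p) x) (1 / p)"
    if f: "f \<in> Lp p" and x: "x \<in> circle" for f x
  proof (cases "HL_max (\<lambda>t. norm (f t) powr p) x")
    case top
    then show ?thesis using K p by (simp add: epow_def ennreal_mult_top)
  next
    case (real m)
    have "ennreal (norm (circle_conv (\<phi> r) f y)) \<le> ennreal (K * m powr (1 / p))"
      if y: "y \<in> circle" "0 < r" "r < 1" "circle_dist x y < lam r" for y r
    proof (rule ennreal_leI, rule field_le_epsilon)
      fix \<epsilon> :: real assume \<epsilon>: "0 < \<epsilon>"
      \<comment> \<open>A level slightly above \<open>M\<^sup>1\<^sup>/\<^sup>p\<close> is positive even if \<open>M = 0\<close>; the excess costs only \<open>\<epsilon>\<close>.\<close>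
      define \<mu> where "\<mu> = m powr (1 / p) + \<epsilon> / K"
      have mu: "0 < \<mu>" unfolding \<mu>_def using \<epsilon> K by (intro add_nonneg_pos) auto
      have "m = (m powr (1 / p)) powr p"
        using real(1) p by (simp add: powr_powr)
      also have "\<dots> \<le> \<mu> powr p"
        unfolding \<mu>_def using \<epsilon> K p by (intro powr_mono2) auto
      finally have "HL_max (\<lambda>t. norm (f t) powr p) x \<le> ennreal (\<mu> powr p)"
        unfolding real(2) by (rule ennreal_leI)
      from conv[OF f x y mu this]
      show "norm (circle_conv (\<phi> r) f y) \<le> K * m powr (1 / p) + \<epsilon>"
        using K by (simp add: \<mu>_def distrib_left)
    qed
    then have "Phi_max \<phi> lam f x \<le> ennreal (K * m powr (1 / p))"
      unfolding Phi_max_def by (intro SUP_least) auto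
    also have "\<dots> = ennreal K * epow (HL_max (\<lambda>t. norm (f t) powr p) x) (1 / p)"
      using real K p by (simp add: epow_def ennreal_mult)
    finally show ?thesis .
  qed
  have weak: "{x \<in> circle. Phi_max \<phi> lam f x > ennreal t} \<in> sets circle_measure \<and>
      emeasure circle_measure {x \<in> circle. Phi_max \<phi> lam f x > ennreal t}
        \<le> ennreal (15 * K powr p / t powr p) * epow (Lp_norm p f) p"
    if f: "f \<in> Lp p" and t: "0 < t" for f t
  proof
    define S where "S = {x \<in> circle. Phi_max \<phi> lam f x > ennreal t}"
    \<comment> \<open>By the pointwise estimate, \<open>M|f|\<^sup>p\<close> exceeds \<open>s\<close> on \<open>S\<close>.\<close>
    define s where "s = (t / K) powr p"
    have s: "0 < s" using t K by (simp add: s_def)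
    obtain U where U: "open U" "S = circle \<inter> U"
      using open_Phi_max_superlevel[of "ennreal t" \<phi> lam f] unfolding S_def by blast
    show "S \<in> sets circle_measure"
      unfolding U(2) using U(1) by (simp add: sets_restrict_space_iff)
    have fm[measurable]: "f \<in> borel_measurable lebesgue" and per: "f (x + 2 * pi) = f x" for x
      using f by (auto simp: Lp_def circle_fun_def)
    have level: "ennreal s < HL_max (\<lambda>t. norm (f t) powr p) x" if x: "x \<in> S" for x
    proof -
      have "ennreal (t / K) < epow (HL_max (\<lambda>t. norm (f t) powr p) x) (1 / p)"
      proof (rule ccontr)
        assume "\<not> ?thesis"
        then have "ennreal K * epow (HL_max (\<lambda>t. norm (f t) powr p) x) (1 / p) \<le> ennreal K * ennreal (t / K)"
          by (intro mult_left_mono) (auto simp: not_less)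
        also have "\<dots> = ennreal t"
          using K t by (simp add: ennreal_mult[symmetric])
        finally have "Phi_max \<phi> lam f x \<le> ennreal t"
          using main[OF f, of x] x by (auto simp: S_def)
        then show False using x by (simp add: S_def not_le[symmetric])
      qed
      then show ?thesis
        unfolding s_def using t K p by (intro less_epow_inverseD) auto
    qed
    have "ennreal s * emeasure lebesgue S
        \<le> 15 * (\<integral>\<^sup>+u. ennreal \<bar>norm (f u) powr p\<bar> \<partial>circle_measure)"
      using level s by (intro HL_max_weak_type) (auto simp: per S_def)
    also have "\<dots> = 15 * epow (Lp_norm p f) p"
      using f p by (subst Lp_norm_powr) (simp_all add: Lp_def)
    finally have "ennreal (1 / s) * (ennreal s * emeasure lebesgue S)
        \<le> ennreal (1 / s) * (15 * epow (Lp_norm p f) p)"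
      by (rule mult_left_mono) simp
    then have "emeasure lebesgue S \<le> ennreal (1 / s) * 15 * epow (Lp_norm p f) p"
      using s by (simp add: mult.assoc[symmetric] ennreal_mult[symmetric])
    also have "ennreal (1 / s) * 15 = ennreal (15 * K powr p / t powr p)"
      using s t K ennreal_mult''[of 15 "1 / s"] by (simp add: s_def powr_divide mult.commute)
    also have "emeasure lebesgue S = emeasure circle_measure S"
      by (rule emeasure_restrict_space[symmetric]) (auto simp: S_def)
    finally show "emeasure circle_measure S \<le> ennreal (15 * K powr p / t powr p) * epow (Lp_norm p f) p" .
  qed
  show ?thesis
  proof (rule conjI, goal_cases pointwise level_sets)
    case pointwise
    show ?case by (rule exI[of _ K]) (use K main in blast)
  next
    case level_sets
    have "0 < 15 * K powr p" using K by simp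
    with weak show ?case by (intro exI[of _ "15 * K powr p"]) blast
  qed
qed

end
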